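(* Let $\mathcal{A}$ be a line arrangement in $\mathbb{P}^2$ of $d=6$ lines whose maximal point multiplicity is $m=3$. Then one of the following cases holds. (1) $\tau(\mathcal{A})=19$, $n_3=4$, and $\mathcal{A}$ is free with exponents $(2,3)$. (2) $\tau(\mathcal{A})=18$, $n_3=3$, and $\mathcal{A}$ is nearly free with exponents $(3,3,3)$. (3) $\tau(\mathcal{A})=17$, $n_3=2$, and $\mathcal{A}$ is minimal POG with exponents $(3,3,4)$. (4) $\tau(\mathcal{A})=16$, $n_3=1$, and $\mathcal{A}$ is obtained from a nodal arrangement $\mathcal{B}$ of $5$ lines by adding a line $L$ passing through exactly one node of $\mathcal{B}$. In this case $\mathcal{A}$ is a curve of type $2$ with exponents $(3,4,4,4)$.
   Context: Let $S=\mathbb{C}[x,y,z]$ with the standard grading. A line arrangement $\mathcal{A}: f=0$ in $\mathbb{P}^2=\mathbb{P}^2_{\mathbb{C}}$ is given by $f=\ell_1\cdots\ell_d$ with $\ell_i\in S_1$ pairwise non-proportional. The multiplicity of a point is the number of lines of $\mathcal{A}$ through it; $n_k$ is the number of points of multiplicity exactly $k$; the total Tjurina number is $\tau(\mathcal{A})=\sum_{k\geq 2}n_k(k-1)^2$. A nodal arrangement is one all of whose multiple points are double points (nodes). Let $AR(f)=\{(a,b,c)\in S^3: af_x+bf_y+cf_z=0\}$, graded by the common degree of $a,b,c$. The exponents $(e_1,\ldots,e_s)$, $e_1\leq\cdots\leq e_s$, of $\mathcal{A}$ are the degrees of a minimal homogeneous generating set of $AR(f)$. $\mathcal{A}$ is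 free if $AR(f)$ is a free $S$-module (equivalently $s=2$). $\mathcal{A}$ is plus-one generated (POG) if $s=3$ and $e_1+e_2=d$; it is nearly free if moreover $e_3=e_2$, and minimal POG if moreover $e_3=e_2+1$. The type of $\mathcal{A}$ is $t(\mathcal{A})=e_1+e_2-d+1$. *)

theory Defs
  imports "HOL-Analysis.Analysis" "HOL-Library.Poly_Mapping"
begin

section \<open>The graded ring of complex polynomials in three variables\<close>

text \<open>
  The variables x, y, z are indexed by the three-element type \<^typ>\<open>3\<close>; monomials are exponent
  vectors, and polynomials are finitely supported functions from monomials to coefficients.
\<close>

type_synonym monom3 = "3 \<Rightarrow>\<^sub>0 nat"
type_synonym poly3 = "monom3 \<Rightarrow>\<^sub>0 complex"

definition monom_deg :: "monom3 \<Rightarrow> nat" where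
  "monom_deg m = (\<Sum>i\<in>UNIV. Poly_Mapping.lookup m i)"

text \<open>As usual, 0 is homogeneous of every degree.\<close>

definition homogeneous :: "nat \<Rightarrow> poly3 \<Rightarrow> bool" where
  "homogeneous k p \<longleftrightarrow> (\<forall>m\<in>Poly_Mapping.keys p. monom_deg m = k)"

definition poly3_eval :: "poly3 \<Rightarrow> complex ^ 3 \<Rightarrow> complex" where
  "poly3_eval p v = (\<Sum>m\<in>Poly_Mapping.keys p.
     Poly_Mapping.lookup p m * (\<Prod>i\<in>UNIV. (v $ i) ^ Poly_Mapping.lookup m i))"

text \<open>
  The exponent subtraction is truncated, but where it truncates the coefficient is 0.
\<close>

definition pdv :: "3 \<Rightarrow> poly3 \<Rightarrow> poly3" where
  "pdv i p = (\<Sum>m\<in>Poly_Mapping.keys p.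
     Poly_Mapping.single (m - Poly_Mapping.single i 1)
       (of_nat (Poly_Mapping.lookup m i) * Poly_Mapping.lookup p m))"

definition proportional :: "poly3 \<Rightarrow> poly3 \<Rightarrow> bool" where
  "proportional p q \<longleftrightarrow> (\<exists>c. c \<noteq> 0 \<and> q = Poly_Mapping.single 0 c * p)"


section \<open>Line arrangements in the projective plane\<close>

text \<open>An arrangement is given by the set of the linear forms defining its lines.\<close>

definition line_arrangement :: "poly3 set \<Rightarrow> bool" where
  "line_arrangement A \<longleftrightarrow> finite A \<and> (\<forall>l\<in>A. l \<noteq> 0 \<and> homogeneous 1 l) \<and>
     (\<forall>l\<in>A. \<forall>l'\<in>A. l \<noteq> l' \<longrightarrow> \<not> proportional l l')"

definition def_poly :: "poly3 set \<Rightarrow> poly3" where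
  "def_poly A = (\<Prod>l\<in>A. l)"

text \<open>Points of the projective plane are the one-dimensional subspaces of \<open>\<complex>\<^sup>3\<close>.\<close>

definition proj_points :: "(complex ^ 3) set set" where
  "proj_points = {P. vec.subspace P \<and> vec.dim P = 1}"

definition on_line :: "(complex ^ 3) set \<Rightarrow> poly3 \<Rightarrow> bool" where
  "on_line P l \<longleftrightarrow> (\<forall>v\<in>P. poly3_eval l v = 0)"

definition point_mult :: "poly3 set \<Rightarrow> (complex ^ 3) set \<Rightarrow> nat" where
  "point_mult A P = card {l\<in>A. on_line P l}"

definition num_points :: "poly3 set \<Rightarrow> nat \<Rightarrow> nat" where
  "num_points A k = card {P\<in>proj_points. point_mult A P = k}"

definition max_mult :: "poly3 set \<Rightarrow> nat" where
  "max_mult A = Max (point_mult A ` proj_points)"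

text \<open>A point lies on at most \<open>card A\<close> lines, so the sum over all \<open>k \<ge> 2\<close> stops there.\<close>

definition total_tjurina :: "poly3 set \<Rightarrow> nat" where
  "total_tjurina A = (\<Sum>k = 2..card A. num_points A k * (k - 1)\<^sup>2)"

definition nodal :: "poly3 set \<Rightarrow> bool" where
  "nodal A \<longleftrightarrow> (\<forall>P\<in>proj_points. point_mult A P \<ge> 2 \<longrightarrow> point_mult A P = 2)"

definition nodes :: "poly3 set \<Rightarrow> (complex ^ 3) set set" where
  "nodes A = {P\<in>proj_points. point_mult A P = 2}"


section \<open>Jacobian syzygies\<close>

definition AR :: "poly3 \<Rightarrow> (poly3 ^ 3) set" where
  "AR f = {g. (\<Sum>i\<in>UNIV. g $ i * pdv i f) = 0}"

global_interpretation syz: module "(*s) :: poly3 \<Rightarrow> poly3 ^ 3 \<Rightarrow> poly3 ^ 3"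
  by unfold_locales (vector algebra_simps)+

definition homogeneous_triple :: "nat \<Rightarrow> poly3 ^ 3 \<Rightarrow> bool" where
  "homogeneous_triple k g \<longleftrightarrow> (\<forall>i. homogeneous k (g $ i))"

definition minimal_generating_set :: "(poly3 ^ 3) set \<Rightarrow> (poly3 ^ 3) set \<Rightarrow> bool" where
  "minimal_generating_set M G \<longleftrightarrow> syz.span G = M \<and> (\<forall>H. H \<subset> G \<longrightarrow> syz.span H \<noteq> M)"

text \<open>
  The list of degrees does not depend on the minimal homogeneous generating set (graded Nakayama
  lemma), so at most one list \<open>es\<close> satisfies this predicate.
\<close>

definition has_exponents :: "poly3 set \<Rightarrow> nat list \<Rightarrow> bool" where
  "has_exponents A es \<longleftrightarrow> sorted es \<and>
     (\<exists>gs. distinct gs \<and> list_all2 homogeneous_triple es gs \<and>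
           minimal_generating_set (AR (def_poly A)) (set gs))"

definition free_arrangement :: "poly3 set \<Rightarrow> bool" where
  "free_arrangement A \<longleftrightarrow> (\<exists>B. syz.independent B \<and> syz.span B = AR (def_poly A))"

definition plus_one_generated :: "poly3 set \<Rightarrow> nat \<Rightarrow> nat \<Rightarrow> nat \<Rightarrow> bool" where
  "plus_one_generated A e1 e2 e3 \<longleftrightarrow> has_exponents A [e1, e2, e3] \<and> e1 + e2 = card A"

definition nearly_free :: "poly3 set \<Rightarrow> bool" where
  "nearly_free A \<longleftrightarrow> (\<exists>e1 e2 e3. plus_one_generated A e1 e2 e3 \<and> e3 = e2)"

definition minimal_POG :: "poly3 set \<Rightarrow> bool" where
  "minimal_POG A \<longleftrightarrow> (\<exists>e1 e2 e3. plus_one_generated A e1 e2 e3 \<and> e3 = e2 + 1)"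

definition has_type :: "poly3 set \<Rightarrow> int \<Rightarrow> bool" where
  "has_type A t \<longleftrightarrow>
     (\<exists>e1 e2 es. has_exponents A (e1 # e2 # es) \<and> t = int e1 + int e2 - int (card A) + 1)"

end

theory Submission
  imports Defs
begin

text \<open>
  Let \<open>P\<close> be a triple point, let \<open>x\<close>, \<open>y\<close>, \<open>w = x + y\<close> be the lines through it and \<open>X\<close>, \<open>Y\<close>, \<open>Z\<close> the
  other three lines.  A Jacobian syzygy of \<open>f = x y w X Y Z\<close> is a derivation that annihilates \<open>f\<close>; it
  therefore maps each of the six forms to a multiple of itself, and the six cofactors add up to 0.
  Modulo the Euler derivation one may assume that \<open>y\<close> is mapped to 0.  Then \<open>x\<close> is mapped to \<open>x w p\<close> and
  \<open>w\<close> has the cofactor \<open>x p\<close> for some polynomial \<open>p\<close>, and the cofactors \<open>b1\<close>, \<open>b2\<close>, \<open>b3\<close> of \<open>X\<close>, \<open>Y\<close>, \<open>Z\<close>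
  satisfy two linear relations \<open>Y b2 = X b1 + d p\<close> and \<open>Z b3 = X b1 + d' p\<close>, where \<open>d\<close> and \<open>d'\<close> are
  scalar multiples of \<open>x w\<close>.  So the module of syzygies is the module of solutions
  \<open>(p, b1, b2, b3)\<close> of these relations (lemmas \<open>syzygy_in_AR\<close> and \<open>AR_is_syzygy\<close>).

  The solutions with \<open>p = 0\<close> are the multiples of \<open>(0, Y Z, X Z, X Y)\<close>, a syzygy of degree 3.  Hence the
  exponents are 3 together with the numbers \<open>k + 2\<close>, where \<open>k\<close> runs through the degrees of minimal
  generators of the ideal \<open>I\<close> of all \<open>p\<close> that occur in a solution; when \<open>1 \<in> I\<close> these are 2 and 3.
  Reducing the relations modulo two of the lines shows that \<open>p d\<close>, \<open>p d'\<close> and \<open>p (d' - d)\<close> lie in the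
  ideals of the points \<open>X \<inter> Y\<close>, \<open>X \<inter> Z\<close> and \<open>Y \<inter> Z\<close>.  These ideals are prime, and the conic \<open>d\<close>, \<open>d'\<close> or
  \<open>d' - d\<close> vanishes at its point exactly when the point lies on \<open>x\<close>, \<open>y\<close> or \<open>w\<close>.
  If \<open>X\<close>, \<open>Y\<close>, \<open>Z\<close> are not concurrent, \<open>I\<close> turns out to be the ideal of
  those of the three points that are double points of the arrangement:

    no point: \<open>I = (1)\<close>, exponents 2, 3;
    one point: \<open>I = (X, Y)\<close>, exponents 3, 3, 3;
    two points: \<open>I = (X, Y Z)\<close>, exponents 3, 3, 4;
    three points: \<open>I = (Y Z, X Z, X Y)\<close>, exponents 3, 4, 4, 4.

  If \<open>X\<close>, \<open>Y\<close>, \<open>Z\<close> meet in a point \<open>Q\<close>, then \<open>I = (m, Y Z)\<close> where \<open>m\<close> is the line \<open>P Q\<close>, and the exponents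
  are again 3, 3, 4.

  It remains to count points.  A triple point other than \<open>P\<close> lies on at least two of \<open>X\<close>, \<open>Y\<close>, \<open>Z\<close>, so \<open>n\<^sub>3\<close> is 1
  plus the number of triple points among the three intersection points, or 2 in the concurrent case.
  Each of the 15 pairs of lines meets in one point, so \<open>n\<^sub>2 + 3 n\<^sub>3 = 15\<close> and \<open>\<tau> = n\<^sub>2 + 4 n\<^sub>3 = 15 + n\<^sub>3\<close>.
\<close>

section \<open>Polynomials in three variables\<close>

definition const3 :: "complex \<Rightarrow> poly3" where
  "const3 c = Poly_Mapping.single 0 c"

definition var3 :: "3 \<Rightarrow> poly3" where
  "var3 i = Poly_Mapping.single (Poly_Mapping.single i 1) 1"

lemma const3_simps [simp]:
  "const3 0 = 0" "const3 1 = 1"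
  by (simp_all add: const3_def)

lemma const3_hom:
  "const3 (a + b) = const3 a + const3 b" "const3 (a * b) = const3 a * const3 b"
  "const3 (- a) = - const3 a" "const3 (a - b) = const3 a - const3 b"
  by (simp_all add: const3_def single_add mult_single single_uminus single_diff)

lemma const3_sum: "const3 (\<Sum>i\<in>I. f i) = (\<Sum>i\<in>I. const3 (f i))"
  by (induction I rule: infinite_finite_induct) (simp_all add: const3_hom)

lemma const3_eq_0_iff [simp]: "const3 c = 0 \<longleftrightarrow> c = 0"
  by (metis const3_def const3_simps(1) lookup_single_eq)

lemma poly3_expansion:
  "p = (\<Sum>m\<in>Poly_Mapping.keys p. Poly_Mapping.single m (Poly_Mapping.lookup p m))" for p :: poly3
  by (rule poly_mapping_eqI) (auto simp: lookup_sum lookup_single when_def in_keys_iff)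

lemma poly3_monomial_induct [case_names single add]:
  fixes p :: poly3
  assumes "\<And>m c. P (Poly_Mapping.single m c)" and "\<And>p q. P p \<Longrightarrow> P q \<Longrightarrow> P (p + q)"
  shows "P p"
proof -
  have z: "P 0" using assms(1)[of 0 0] by simp
  have "P (\<Sum>m\<in>S. Poly_Mapping.single m (Poly_Mapping.lookup p m))" for S
    by (induction S rule: infinite_finite_induct) (auto simp: z assms)
  then show ?thesis using poly3_expansion[of p] by metis
qed

lemma single_eq_const_times_vars:
  "Poly_Mapping.single m c = const3 c * (\<Prod>i\<in>UNIV. var3 i ^ Poly_Mapping.lookup m i)"
proof -
  have pow: "var3 i ^ k = Poly_Mapping.single (Poly_Mapping.single i k) 1" for i k
    by (induction k) (simp_all add: var3_def mult_single flip: single_add)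
  have prod: "(\<Prod>i\<in>I. Poly_Mapping.single (f i) 1 :: poly3) = Poly_Mapping.single (\<Sum>i\<in>I. f i) 1"
    if "finite I" for I :: "3 set" and f
    using that by (induction I) (simp_all add: mult_single)
  have m: "m = (\<Sum>i\<in>UNIV. Poly_Mapping.single i (Poly_Mapping.lookup m i))"
    by (rule poly_mapping_eqI) (simp add: lookup_sum lookup_single when_def)
  show ?thesis
    unfolding pow prod[OF finite] m[symmetric] by (simp add: const3_def mult_single)
qed

lemma poly3_ring_induct [case_names const var add mult]:
  fixes p :: poly3
  assumes "\<And>c. P (const3 c)" and "\<And>i. P (var3 i)"
    and "\<And>p q. P p \<Longrightarrow> P q \<Longrightarrow> P (p + q)" and "\<And>p q. P p \<Longrightarrow> P q \<Longrightarrow> P (p * q)"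
  shows "P p"
proof (induction p rule: poly3_monomial_induct)
  case (single m c)
  have one: "P 1" using assms(1)[of 1] by simp
  have "P (var3 i ^ k)" for i k
    by (induction k) (auto simp: one assms)
  then have "P (\<Prod>i\<in>I. var3 i ^ Poly_Mapping.lookup m i)" for I
    by (induction I rule: infinite_finite_induct) (auto simp: one assms)
  then show ?case unfolding single_eq_const_times_vars using assms by blast
qed (rule assms)

section \<open>Homogeneous polynomials\<close>

lemma monom_deg_add: "monom_deg (m + n) = monom_deg m + monom_deg n"
  by (simp add: monom_deg_def lookup_add sum.distrib)

lemma monom_deg_0_iff: "monom_deg m = 0 \<longleftrightarrow> m = 0"
proof
  assume "monom_deg m = 0"
  then show "m = 0" by (intro poly_mapping_eqI) (simp add: monom_deg_def)
qed (simp add: monom_deg_def)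

lemma homogeneous_0 [simp]: "homogeneous k 0"
  by (simp add: homogeneous_def)

lemma homogeneous_iff: "homogeneous k p \<longleftrightarrow> (\<forall>m. Poly_Mapping.lookup p m \<noteq> 0 \<longrightarrow> monom_deg m = k)"
  by (auto simp: homogeneous_def in_keys_iff)

lemma homogeneous_add: "homogeneous k p \<Longrightarrow> homogeneous k q \<Longrightarrow> homogeneous k (p + q)"
  using Poly_Mapping.keys_add[of p q] unfolding homogeneous_def by blast

lemma homogeneous_uminus: "homogeneous k p \<Longrightarrow> homogeneous k (- p)"
  by (auto simp: homogeneous_iff)

lemma homogeneous_diff: "homogeneous k p \<Longrightarrow> homogeneous k q \<Longrightarrow> homogeneous k (p - q)"
  using homogeneous_add[of k p "- q"] by (simp add: homogeneous_uminus)

lemma homogeneous_sum: "(\<And>i. i \<in> I \<Longrightarrow> homogeneous k (f i)) \<Longrightarrow> homogeneous k (\<Sum>i\<in>I. f i)"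
  by (induction I rule: infinite_finite_induct) (auto simp: homogeneous_add)

lemma homogeneous_mult:
  assumes "homogeneous k p" "homogeneous l q" shows "homogeneous (k + l) (p * q)"
  unfolding homogeneous_def
proof
  fix m assume "m \<in> Poly_Mapping.keys (p * q)"
  with keys_mult obtain a b where "m = a + b" "a \<in> Poly_Mapping.keys p" "b \<in> Poly_Mapping.keys q"
    by blast
  with assms show "monom_deg m = k + l" unfolding homogeneous_def by (metis monom_deg_add)
qed

lemma homogeneous_mult':
  assumes "homogeneous k p" "homogeneous l q" "n = k + l" shows "homogeneous n (p * q)"
  using assms homogeneous_mult by blast

lemma homogeneous_const [simp]: "homogeneous 0 (const3 c)"
  by (simp add: homogeneous_iff const3_def lookup_single when_def monom_deg_0_iff)

lemma homogeneous_const_mult: "homogeneous k p \<Longrightarrow> homogeneous k (const3 c * p)"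
  by (rule homogeneous_mult'[OF homogeneous_const]) auto

definition hom_part :: "nat \<Rightarrow> poly3 \<Rightarrow> poly3" where
  "hom_part k p = (\<Sum>m | m \<in> Poly_Mapping.keys p \<and> monom_deg m = k.
     Poly_Mapping.single m (Poly_Mapping.lookup p m))"

lemma lookup_hom_part:
  "Poly_Mapping.lookup (hom_part k p) m = (if monom_deg m = k then Poly_Mapping.lookup p m else 0)"
proof -
  have "Poly_Mapping.lookup (hom_part k p) m =
      (\<Sum>n | n \<in> Poly_Mapping.keys p \<and> monom_deg n = k. if n = m then Poly_Mapping.lookup p n else 0)"
    by (simp add: hom_part_def lookup_sum lookup_single when_def)
  also have "\<dots> = (if monom_deg m = k then Poly_Mapping.lookup p m else 0)"
    by (simp add: sum.delta' in_keys_iff)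
  finally show ?thesis .
qed

lemma hom_part_add: "hom_part k (p + q) = hom_part k p + hom_part k q"
  by (rule poly_mapping_eqI) (simp add: lookup_hom_part lookup_add)

lemma homogeneous_hom_part [simp]: "homogeneous k (hom_part k p)"
  by (simp add: homogeneous_iff lookup_hom_part)

lemma hom_part_homogeneous: "homogeneous k p \<Longrightarrow> hom_part k p = p"
  by (rule poly_mapping_eqI) (auto simp: lookup_hom_part homogeneous_iff)

lemma hom_part_homogeneous_other: "homogeneous k p \<Longrightarrow> k \<noteq> l \<Longrightarrow> hom_part l p = 0"
  by (rule poly_mapping_eqI) (auto simp: lookup_hom_part homogeneous_iff)

lemma hom_part_mult:
  assumes "homogeneous k p"
  shows "hom_part (k + l) (p * q) = p * hom_part l q"
proof (induction q rule: poly3_monomial_induct)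
  case (single m c)
  have s: "homogeneous (monom_deg m) (Poly_Mapping.single m c)"
    by (auto simp: homogeneous_iff lookup_single when_def)
  have ps: "homogeneous (k + monom_deg m) (p * Poly_Mapping.single m c)"
    using homogeneous_mult[OF assms s] .
  show ?case
    by (cases "monom_deg m = l")
      (use hom_part_homogeneous[OF ps] hom_part_homogeneous_other[OF ps]
        hom_part_homogeneous[OF s] hom_part_homogeneous_other[OF s] in auto)
qed (simp add: hom_part_add algebra_simps)

section \<open>Constant term and substitution\<close>

abbreviation const_term :: "poly3 \<Rightarrow> complex" where
  "const_term p \<equiv> Poly_Mapping.lookup p 0"

lemma const_term_mult: "const_term (p * q) = const_term p * const_term q"
proof (induction p rule: poly3_monomial_induct)
  case (single m c)
  show ?case
  proof (induction q rule: poly3_monomial_induct)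
    case (single n d)
    have "m + n = 0 \<longleftrightarrow> m = 0 \<and> n = 0"
      by (metis add_eq_0_iff_both_eq_0 monom_deg_0_iff monom_deg_add)
    then show ?case by (auto simp: mult_single lookup_single when_def)
  qed (simp add: lookup_add algebra_simps)
qed (simp add: lookup_add algebra_simps)

lemma const_term_homogeneous: "homogeneous k p \<Longrightarrow> k > 0 \<Longrightarrow> const_term p = 0"
  by (metis homogeneous_iff less_irrefl monom_deg_0_iff)

definition subst3 :: "(3 \<Rightarrow> poly3) \<Rightarrow> poly3 \<Rightarrow> poly3" where
  "subst3 s p = (\<Sum>m\<in>Poly_Mapping.keys p.
     const3 (Poly_Mapping.lookup p m) * (\<Prod>i\<in>UNIV. s i ^ Poly_Mapping.lookup m i))"

lemma subst3_superset:
  assumes "finite S" "Poly_Mapping.keys p \<subseteq> S"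
  shows "subst3 s p = (\<Sum>m\<in>S.
     const3 (Poly_Mapping.lookup p m) * (\<Prod>i\<in>UNIV. s i ^ Poly_Mapping.lookup m i))"
  unfolding subst3_def by (rule sum.mono_neutral_left) (use assms in \<open>auto simp: in_keys_iff\<close>)

lemma subst3_single:
  "subst3 s (Poly_Mapping.single m c) = const3 c * (\<Prod>i\<in>UNIV. s i ^ Poly_Mapping.lookup m i)"
  by (subst subst3_superset[of "{m}"]) auto

lemma subst3_add: "subst3 s (p + q) = subst3 s p + subst3 s q"
proof -
  let ?S = "Poly_Mapping.keys p \<union> Poly_Mapping.keys q"
  have "Poly_Mapping.keys (p + q) \<subseteq> ?S" by (rule Poly_Mapping.keys_add)
  then show ?thesis
    by (subst (1 2 3) subst3_superset[of ?S])
      (auto simp: lookup_add const3_hom algebra_simps sum.distrib)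
qed

lemma subst3_mult: "subst3 s (p * q) = subst3 s p * subst3 s q"
proof (induction p rule: poly3_monomial_induct)
  case (single m c)
  show ?case
    by (induction q rule: poly3_monomial_induct)
      (simp_all add: mult_single subst3_single lookup_add const3_hom power_add prod.distrib
        subst3_add algebra_simps)
qed (simp add: subst3_add algebra_simps)

lemma subst3_const: "subst3 s (const3 c) = const3 c"
  by (simp add: const3_def subst3_single)

lemma subst3_var: "subst3 s (var3 i) = s i"
proof -
  have "(\<Prod>j\<in>UNIV. s j ^ Poly_Mapping.lookup (Poly_Mapping.single i 1) j) = (\<Prod>j\<in>UNIV. if j = i then s j else 1)"
    by (rule prod.cong) (auto simp: lookup_single when_def)
  then show ?thesis by (simp add: var3_def subst3_single)
qed

lemma subst3_sum: "subst3 s (\<Sum>i\<in>I. f i) = (\<Sum>i\<in>I. subst3 s (f i))"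
  by (induction I rule: infinite_finite_induct)
     (use subst3_const[of s 0] in \<open>simp_all add: subst3_add\<close>)

section \<open>Partial derivatives\<close>

lemma pdv_superset:
  assumes "finite S" "Poly_Mapping.keys p \<subseteq> S"
  shows "pdv i p = (\<Sum>m\<in>S.
     Poly_Mapping.single (m - Poly_Mapping.single i 1)
       (of_nat (Poly_Mapping.lookup m i) * Poly_Mapping.lookup p m))"
  unfolding pdv_def by (rule sum.mono_neutral_left) (use assms in \<open>auto simp: in_keys_iff\<close>)

lemma pdv_single:
  "pdv i (Poly_Mapping.single m c) =
     Poly_Mapping.single (m - Poly_Mapping.single i 1) (of_nat (Poly_Mapping.lookup m i) * c)"
  by (subst pdv_superset[of "{m}"]) auto

lemma pdv_add: "pdv i (p + q) = pdv i p + pdv i q"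
proof -
  let ?S = "Poly_Mapping.keys p \<union> Poly_Mapping.keys q"
  have "Poly_Mapping.keys (p + q) \<subseteq> ?S" by (rule Poly_Mapping.keys_add)
  then show ?thesis
    by (subst (1 2 3) pdv_superset[of ?S])
      (auto simp: lookup_add single_add algebra_simps sum.distrib)
qed

lemma pdv_mult: "pdv i (p * q) = pdv i p * q + p * pdv i q"
proof (induction p rule: poly3_monomial_induct)
  case (single m c)
  show ?case
  proof (induction q rule: poly3_monomial_induct)
    case (single n d)
    have l: "m - Poly_Mapping.single i 1 + n = m + n - Poly_Mapping.single i 1"
      if "Poly_Mapping.lookup m i \<noteq> 0" for m n :: monom3
      using that
      by (intro poly_mapping_eqI) (auto simp: lookup_add lookup_minus lookup_single when_def)
    show ?case
      using l[of m n] l[of n m]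
      by (cases "Poly_Mapping.lookup m i = 0"; cases "Poly_Mapping.lookup n i = 0")
        (auto simp: mult_single pdv_single lookup_add algebra_simps single_add)
  qed (simp add: pdv_add algebra_simps)
qed (simp add: pdv_add algebra_simps)

lemma pdv_const: "pdv i (const3 c) = 0"
  by (simp add: const3_def pdv_single)

lemma pdv_var: "pdv i (var3 j) = (if i = j then 1 else 0)"
  by (auto simp: var3_def pdv_single lookup_single)

section \<open>Linear forms\<close>

definition lin :: "complex ^ 3 \<Rightarrow> poly3" where
  "lin a = (\<Sum>i\<in>UNIV. const3 (a $ i) * var3 i)"

text \<open>
  This form is bilinear, not Hermitian: \<open>dot a v\<close> is the value of the linear form \<open>lin a\<close> at \<open>v\<close>.
\<close>

definition dot :: "complex ^ 3 \<Rightarrow> complex ^ 3 \<Rightarrow> complex" where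
  "dot a v = (\<Sum>i\<in>UNIV. a $ i * v $ i)"

definition cross :: "complex ^ 3 \<Rightarrow> complex ^ 3 \<Rightarrow> complex ^ 3" where
  "cross a b = vector [a$2 * b$3 - a$3 * b$2, a$3 * b$1 - a$1 * b$3, a$1 * b$2 - a$2 * b$1]"

lemmas vec3_simps = dot_def cross_def sum_3 vec_eq_iff forall_3

lemma lookup_lin:
  "Poly_Mapping.lookup (lin a) m = (\<Sum>i\<in>UNIV. if Poly_Mapping.single i 1 = m then a $ i else 0)"
  by (simp add: lin_def lookup_sum var3_def const3_def mult_single lookup_single when_def)

lemma single_one_inject: "Poly_Mapping.single i (1::nat) = Poly_Mapping.single j 1 \<longleftrightarrow> i = j"
  by (metis lookup_single_eq lookup_single_not_eq zero_neq_one)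

lemma lookup_lin_single [simp]: "Poly_Mapping.lookup (lin a) (Poly_Mapping.single i (Suc 0)) = a $ i"
  by (simp add: lookup_lin single_one_inject[unfolded One_nat_def])

lemma lin_inject [simp]: "lin a = lin b \<longleftrightarrow> a = b"
  by (metis lookup_lin_single vec_eq_iff)

lemma lin_0 [simp]: "lin 0 = 0"
  by (simp add: lin_def)

lemma lin_eq_0_iff [simp]: "lin a = 0 \<longleftrightarrow> a = 0"
  using lin_inject[of a 0] by simp

lemma lin_hom:
  "lin (a + b) = lin a + lin b" "lin (a - b) = lin a - lin b" "lin (- a) = - lin a"
  "lin (c *s a) = const3 c * lin a"
  by (simp_all add: lin_def const3_hom algebra_simps sum.distrib sum_subtractf sum_negf sum_distrib_left)

lemma homogeneous_var: "homogeneous 1 (var3 i)"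
  by (simp add: homogeneous_iff var3_def lookup_single when_def monom_deg_def)

lemma homogeneous_lin [simp]: "homogeneous 1 (lin a)"
  unfolding lin_def by (intro homogeneous_sum homogeneous_const_mult homogeneous_var)

lemma homogeneous_1_imp_lin:
  assumes "homogeneous 1 p" shows "\<exists>a. p = lin a"
proof -
  have deg1: "\<exists>i. m = Poly_Mapping.single i 1" if "monom_deg m = 1" for m
  proof -
    have "m \<noteq> 0" using that by (auto simp: monom_deg_def)
    then obtain i where i: "Poly_Mapping.lookup m i \<noteq> 0"
      by (metis lookup_zero poly_mapping_eqI)
    have "monom_deg m = Poly_Mapping.lookup m i + (\<Sum>j\<in>UNIV - {i}. Poly_Mapping.lookup m j)"
      unfolding monom_deg_def by (rule sum.remove) auto
    with i that have "Poly_Mapping.lookup m i = 1" and "(\<Sum>j\<in>UNIV - {i}. Poly_Mapping.lookup m j) = 0"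
      by linarith+
    then have "Poly_Mapping.lookup m i = 1" "\<And>j. j \<noteq> i \<Longrightarrow> Poly_Mapping.lookup m j = 0"
      by auto
    then have "m = Poly_Mapping.single i 1"
      by (intro poly_mapping_eqI) (auto simp: lookup_single when_def)
    then show ?thesis ..
  qed
  let ?a = "\<chi> i. Poly_Mapping.lookup p (Poly_Mapping.single i 1)"
  have "p = lin ?a"
  proof (rule poly_mapping_eqI)
    fix m show "Poly_Mapping.lookup p m = Poly_Mapping.lookup (lin ?a) m"
    proof (cases "monom_deg m = 1")
      case True
      with deg1 obtain i where "m = Poly_Mapping.single i 1" by blast
      then show ?thesis by simp
    next
      case False
      then show ?thesis using assms homogeneous_lin[of ?a] unfolding homogeneous_iff by metis
    qed
  qed
  then show ?thesis ..
qed

lemma pdv_0: "pdv i 0 = 0"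
  by (simp add: pdv_def)

lemma pdv_sum: "pdv j (\<Sum>i\<in>I. f i) = (\<Sum>i\<in>I. pdv j (f i))"
  by (induction I rule: infinite_finite_induct) (simp_all add: pdv_add pdv_0)

lemma pdv_lin: "pdv i (lin a) = const3 (a $ i)"
  by (simp add: lin_def pdv_sum pdv_mult pdv_const pdv_var if_distrib sum.delta cong: if_cong)

lemma poly3_eval_lin: "poly3_eval (lin a) v = dot a v"
proof -
  let ?e = "\<lambda>i::3. Poly_Mapping.single i (1::nat)"
  have k: "Poly_Mapping.keys (lin a) \<subseteq> range ?e"
  proof
    fix m assume "m \<in> Poly_Mapping.keys (lin a)"
    then have "(\<Sum>i\<in>UNIV. if ?e i = m then a $ i else 0) \<noteq> 0"
      by (simp add: in_keys_iff lookup_lin)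
    then obtain i where "(if ?e i = m then a $ i else 0) \<noteq> 0" by (rule sum.not_neutral_contains_not_neutral)
    then have "m = ?e i" by (metis (full_types))
    then show "m \<in> range ?e" by blast
  qed
  have p: "(\<Prod>j\<in>UNIV. (v $ j) ^ Poly_Mapping.lookup (?e i) j) = v $ i" for i
  proof -
    have "(\<Prod>j\<in>UNIV. (v $ j) ^ Poly_Mapping.lookup (?e i) j) = (\<Prod>j\<in>UNIV. if j = i then v $ j else 1)"
      by (rule prod.cong) (auto simp: lookup_single when_def)
    then show ?thesis by simp
  qed
  have "poly3_eval (lin a) v = (\<Sum>m\<in>range ?e.
     Poly_Mapping.lookup (lin a) m * (\<Prod>i\<in>UNIV. (v $ i) ^ Poly_Mapping.lookup m i))"
    unfolding poly3_eval_def by (rule sum.mono_neutral_left) (use k in \<open>auto simp: in_keys_iff\<close>)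
  also have "\<dots> = (\<Sum>i\<in>UNIV. Poly_Mapping.lookup (lin a) (?e i) *
      (\<Prod>j\<in>UNIV. (v $ j) ^ Poly_Mapping.lookup (?e i) j))"
    by (subst sum.reindex) (simp_all add: inj_on_def single_one_inject[unfolded One_nat_def])
  also have "\<dots> = (\<Sum>i\<in>UNIV. a $ i * v $ i)"
    unfolding p by simp
  finally show ?thesis by (simp add: dot_def)
qed

lemma subst3_lin: "subst3 s (lin a) = (\<Sum>i\<in>UNIV. const3 (a $ i) * s i)"
  by (simp add: lin_def subst3_sum subst3_mult subst3_const subst3_var)

section \<open>Bilinear algebra in \<open>\<complex>\<^sup>3\<close>\<close>

lemma dot_simps:
  "dot (a + b) v = dot a v + dot b v" "dot (a - b) v = dot a v - dot b v"
  "dot (c *s a) v = c * dot a v" "dot a (c *s v) = c * dot a v"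
  "dot 0 v = 0" "dot a 0 = 0"
  by (simp_all add: vec3_simps algebra_simps)

lemma dot_cross_self: "dot a (cross a b) = 0" "dot b (cross a b) = 0"
  by (simp_all add: vec3_simps algebra_simps)

lemma dot_cross_rotate: "dot c (cross a b) = dot a (cross b c)"
  by (simp add: vec3_simps algebra_simps)

lemma cross_commute: "cross b a = - cross a b"
  by (simp add: vec3_simps algebra_simps)

lemma cross_scale: "cross a (c *s b) = c *s cross a b" "cross (c *s a) b = c *s cross a b"
  by (simp_all add: vec3_simps algebra_simps)

lemma cross_add: "cross a (b + c) = cross a b + cross a c" "cross (a + b) c = cross a c + cross b c"
  by (simp_all add: vec3_simps algebra_simps)

lemma cross_self [simp]: "cross a a = 0"
  by (simp add: vec3_simps)

lemma cross_eq_0_imp_scale: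
  assumes "cross a b = 0" "a \<noteq> 0" shows "\<exists>c. b = c *s a"
proof -
  from assms(2) obtain i where i: "a $ i \<noteq> 0" by (auto simp: vec_eq_iff)
  have "b $ j * a $ i = b $ i * a $ j" for j
    using assms(1) exhaust_3[of i] exhaust_3[of j] by (auto simp: vec3_simps algebra_simps)
  then have "b = (b $ i / a $ i) *s a"
    using i by (simp add: vec_eq_iff field_simps)
  then show ?thesis ..
qed

lemma exists_dot_neq_0: "n \<noteq> 0 \<Longrightarrow> \<exists>c. dot c n \<noteq> 0"
proof -
  assume "n \<noteq> 0"
  then obtain i where "n $ i \<noteq> 0" by (auto simp: vec_eq_iff)
  moreover have "dot (axis i 1) n = n $ i"
    by (simp add: dot_def axis_def if_distrib[of "\<lambda>x. x * _"] cong: if_cong)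
  ultimately show ?thesis by metis
qed

lemma exists_cross_neq_0: "a \<noteq> 0 \<Longrightarrow> \<exists>b. cross a b \<noteq> 0"
proof (rule ccontr)
  assume "a \<noteq> 0" "\<nexists>b. cross a b \<noteq> 0"
  then have *: "cross a (axis i 1) = 0" for i by blast
  have "a = 0" using *[of 1] *[of 2] by (auto simp: vec3_simps axis_def)
  with \<open>a \<noteq> 0\<close> show False ..
qed

text \<open>
  The last clause says that the matrices formed by \<open>a, b, c\<close> and by \<open>u, v, w\<close> are inverse to each other
  in the order opposite to that of the nine equations; it is the form in which a vector is expanded.
\<close>

definition dual_bases where
  "dual_bases a b c u v w \<longleftrightarrow>
     dot a u = 1 \<and> dot b u = 0 \<and> dot c u = 0 \<and>
     dot a v = 0 \<and> dot b v = 1 \<and> dot c v = 0 \<and>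
     dot a w = 0 \<and> dot b w = 0 \<and> dot c w = 1 \<and>
     (\<forall>i j. a $ i * u $ j + b $ i * v $ j + c $ i * w $ j = (if i = j then 1 else 0))"

lemma dual_bases_exist:
  assumes "dot c (cross a b) \<noteq> 0"
  shows "\<exists>u v. dual_bases a b c u v ((1 / dot c (cross a b)) *s cross a b)"
proof -
  define D where "D = dot c (cross a b)"
  have D: "D \<noteq> 0" using assms by (simp add: D_def)
  have eqs: "dot a (cross b c) = D" "dot b (cross c a) = D" "dot c (cross a b) = D"
    by (simp_all add: D_def vec3_simps algebra_simps)
  have "\<forall>i j. a $ i * cross b c $ j + b $ i * cross c a $ j + c $ i * cross a b $ j
        = (if i = j then D else 0)"
    unfolding D_def by (simp add: vec3_simps algebra_simps)
  then have "\<forall>i j. a $ i * (cross b c $ j / D) + b $ i * (cross c a $ j / D) + c $ i * (cross a b $ j / D)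
        = (if i = j then 1 else 0)"
    using D by (simp add: field_simps)
  then have "dual_bases a b c ((1/D) *s cross b c) ((1/D) *s cross c a) ((1/D) *s cross a b)"
    using D unfolding dual_bases_def by (simp add: dot_simps dot_cross_self eqs)
  then show ?thesis unfolding D_def by blast
qed

lemma dual_bases_expand:
  assumes "dual_bases a b c u v w"
  shows "x = dot x u *s a + dot x v *s b + dot x w *s c"
proof -
  have "x $ i = (dot x u *s a + dot x v *s b + dot x w *s c) $ i" for i
  proof -
    have "x $ i = (\<Sum>j\<in>UNIV. x $ j * (a $ i * u $ j + b $ i * v $ j + c $ i * w $ j))"
      using assms unfolding dual_bases_def
      by (simp add: if_distrib[of "\<lambda>y. _ * y"] cong: if_cong)
    also have "\<dots> = (dot x u *s a + dot x v *s b + dot x w *s c) $ i"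
      by (simp add: dot_def sum_3 algebra_simps)
    finally show ?thesis .
  qed
  then show ?thesis unfolding vec_eq_iff by blast
qed

lemma dual_bases_var:
  assumes "dual_bases a b c u v w"
  shows "var3 i = const3 (u $ i) * lin a + const3 (v $ i) * lin b + const3 (w $ i) * lin c"
proof -
  let ?e = "axis i 1 :: complex ^ 3"
  have e: "dot ?e z = z $ i" for z
    by (simp add: dot_def axis_def if_distrib[of "\<lambda>x. x * _"] cong: if_cong)
  have "var3 i = lin ?e"
    by (simp add: lin_def axis_def if_distrib[of const3] if_distrib[of "\<lambda>x. x * _"] cong: if_cong)
  also have "\<dots> = lin (u $ i *s a + v $ i *s b + w $ i *s c)"
    using dual_bases_expand[OF assms(1), of ?e] by (simp only: e)
  finally show ?thesis by (simp add: lin_hom)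
qed

section \<open>Ideals of lines and points\<close>

definition ideal2 :: "poly3 \<Rightarrow> poly3 \<Rightarrow> poly3 set" where
  "ideal2 X Y = {X * u + Y * v | u v. True}"

lemma ideal2I: "p = X * u + Y * v \<Longrightarrow> p \<in> ideal2 X Y"
  by (auto simp: ideal2_def)

lemma ideal2E: "p \<in> ideal2 X Y \<Longrightarrow> (\<And>u v. p = X * u + Y * v \<Longrightarrow> thesis) \<Longrightarrow> thesis"
  by (auto simp: ideal2_def)

lemma ideal2_add: "p \<in> ideal2 X Y \<Longrightarrow> q \<in> ideal2 X Y \<Longrightarrow> p + q \<in> ideal2 X Y"
proof (elim ideal2E)
  fix u v u' v' assume "p = X * u + Y * v" "q = X * u' + Y * v'"
  then show ?thesis by (intro ideal2I[of _ _ "u + u'" _ "v + v'"]) (simp add: algebra_simps)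
qed

lemma ideal2_mult: "p \<in> ideal2 X Y \<Longrightarrow> r * p \<in> ideal2 X Y"
proof (elim ideal2E)
  fix u v assume "p = X * u + Y * v"
  then show ?thesis by (intro ideal2I[of _ _ "r * u" _ "r * v"]) (simp add: algebra_simps)
qed

lemma ideal2_uminus: "p \<in> ideal2 X Y \<Longrightarrow> - p \<in> ideal2 X Y"
  using ideal2_mult[of p X Y "-1"] by simp

lemma ideal2_diff: "p \<in> ideal2 X Y \<Longrightarrow> q \<in> ideal2 X Y \<Longrightarrow> p - q \<in> ideal2 X Y"
  using ideal2_add[OF _ ideal2_uminus] by fastforce

lemma ideal2_gens: "X \<in> ideal2 X Y" "Y \<in> ideal2 X Y" "0 \<in> ideal2 X Y"
  by (rule ideal2I[of _ _ 1 _ 0], simp) (rule ideal2I[of _ _ 0 _ 1], simp, rule ideal2I[of _ _ 0 _ 0], simp)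

text \<open>
  Both sides are ring homomorphisms modulo the ideal, so it suffices to compare them on the variables.
\<close>

lemma subst3_cong_mod:
  assumes "\<And>i. var3 i - s i \<in> ideal2 X Y"
  shows "p - subst3 s p \<in> ideal2 X Y"
proof (induction p rule: poly3_ring_induct)
  case (const c) then show ?case by (simp add: subst3_const ideal2_gens)
next
  case (var i) then show ?case by (simp add: subst3_var assms)
next
  case (add p q)
  have "p + q - subst3 s (p + q) = (p - subst3 s p) + (q - subst3 s q)"
    by (simp add: subst3_add)
  then show ?case using add ideal2_add by metis
next
  case (mult p q)
  have "p * q - subst3 s (p * q) = p * (q - subst3 s q) + subst3 s q * (p - subst3 s p)"
    by (simp add: subst3_mult algebra_simps)
  then show ?case using mult ideal2_add ideal2_mult by metis
qed

lemma subst3_kernel: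
  assumes "\<And>i. var3 i - s i \<in> ideal2 X Y" "subst3 s X = 0" "subst3 s Y = 0"
  shows "p \<in> ideal2 X Y \<longleftrightarrow> subst3 s p = 0"
proof
  assume "p \<in> ideal2 X Y"
  then show "subst3 s p = 0" by (elim ideal2E) (simp add: subst3_add subst3_mult assms)
next
  assume "subst3 s p = 0"
  then show "p \<in> ideal2 X Y" using subst3_cong_mod[of s X Y p] assms by simp
qed

text \<open>
  The quotient by the ideal of a point is realised inside the ring: restriction to the line spanned
  by \<open>w\<close>, the common zero of \<open>a\<close> and \<open>b\<close>, is an endomorphism whose kernel is the ideal.  So the ideal is
  prime because polynomials form a domain.
\<close>

lemma point_projection:
  assumes "dual_bases a b c u v w"
  defines "s \<equiv> \<lambda>i. const3 (w $ i) * lin c"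
  shows "p \<in> ideal2 (lin a) (lin b) \<longleftrightarrow> subst3 s p = 0"
    and "subst3 s (lin x) = const3 (dot x w) * lin c"
proof -
  have s: "subst3 s (lin x) = const3 (dot x w) * lin c" for x
    by (simp add: subst3_lin s_def dot_def const3_sum const3_hom sum_distrib_right mult.assoc)
  show "subst3 s (lin x) = const3 (dot x w) * lin c" by (rule s)
  have "var3 i - s i \<in> ideal2 (lin a) (lin b)" for i
    by (intro ideal2I[of _ _ "const3 (u $ i)" _ "const3 (v $ i)"])
       (simp add: dual_bases_var[OF assms(1)] s_def algebra_simps)
  then show "p \<in> ideal2 (lin a) (lin b) \<longleftrightarrow> subst3 s p = 0"
    by (rule subst3_kernel) (use assms(1) in \<open>simp_all add: s dual_bases_def\<close>)
qed

text \<open>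
  The analogue for a line: restriction to the plane spanned by \<open>v\<close> and \<open>w\<close>, on which \<open>a\<close> vanishes.
\<close>

lemma line_projection:
  assumes "dual_bases a b c u v w"
  defines "s \<equiv> \<lambda>i. const3 (v $ i) * lin b + const3 (w $ i) * lin c"
  shows "lin a dvd p \<longleftrightarrow> subst3 s p = 0"
proof -
  have s: "subst3 s (lin x) = const3 (dot x v) * lin b + const3 (dot x w) * lin c" for x
    by (simp add: subst3_lin s_def dot_def sum_3 const3_hom algebra_simps)
  have "var3 i - s i \<in> ideal2 (lin a) 0" for i
    by (intro ideal2I[of _ _ "const3 (u $ i)" _ 0])
       (simp add: dual_bases_var[OF assms(1)] s_def algebra_simps)
  then have "p \<in> ideal2 (lin a) 0 \<longleftrightarrow> subst3 s p = 0"
    by (rule subst3_kernel)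
       (use assms(1) subst3_const[of s 0] in \<open>simp_all add: s dual_bases_def\<close>)
  then show ?thesis by (auto simp: ideal2_def dvd_def)
qed

lemma lin_prime:
  assumes "a \<noteq> 0" "lin a dvd p * q" shows "lin a dvd p \<or> lin a dvd q"
proof -
  obtain b where "cross a b \<noteq> 0" using exists_cross_neq_0[OF assms(1)] by blast
  then obtain c where "dot c (cross a b) \<noteq> 0" using exists_dot_neq_0 by blast
  then obtain u v w where "dual_bases a b c u v w" using dual_bases_exist by blast
  from line_projection[OF this] assms(2) show ?thesis by (simp add: subst3_mult)
qed

lemma point_ideal_prime:
  assumes "cross a b \<noteq> 0" "p * q \<in> ideal2 (lin a) (lin b)"
  shows "p \<in> ideal2 (lin a) (lin b) \<or> q \<in> ideal2 (lin a) (lin b)"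
proof -
  obtain c where "dot c (cross a b) \<noteq> 0" using exists_dot_neq_0[OF assms(1)] by blast
  then obtain u v w where "dual_bases a b c u v w" using dual_bases_exist by blast
  from point_projection(1)[OF this] assms(2) show ?thesis by (simp add: subst3_mult)
qed

lemma lin_in_point_ideal_iff:
  assumes "cross a b \<noteq> 0"
  shows "lin x \<in> ideal2 (lin a) (lin b) \<longleftrightarrow> dot x (cross a b) = 0"
proof -
  obtain c where c: "dot c (cross a b) \<noteq> 0" using exists_dot_neq_0[OF assms(1)] by blast
  then obtain u v where uv: "dual_bases a b c u v ((1 / dot c (cross a b)) *s cross a b)"
    using dual_bases_exist by blast
  have "c \<noteq> 0" using c by (auto simp: dot_simps)
  with c show ?thesis unfolding point_projection[OF uv] by (simp add: dot_simps)
qed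

lemma const_notin_point_ideal: "c \<noteq> 0 \<Longrightarrow> const3 c \<notin> ideal2 (lin a) (lin b)"
proof
  assume "c \<noteq> 0" "const3 c \<in> ideal2 (lin a) (lin b)"
  moreover have "const_term (lin a) = 0" for a
    using const_term_homogeneous[OF homogeneous_lin] by simp
  ultimately have "const_term (const3 c) = 0"
    by (elim ideal2E) (simp add: lookup_add const_term_mult)
  with \<open>c \<noteq> 0\<close> show False by (simp add: const3_def)
qed

text \<open>
  A form divisible by \<open>lin a\<close> lies in the ideal of every point of the line, so it vanishes at all points
  \<open>cross c a\<close>.
\<close>

lemma lin_dvd_lin_iff: "a \<noteq> 0 \<Longrightarrow> lin a dvd lin b \<longleftrightarrow> cross a b = 0"
proof
  assume "a \<noteq> 0" "cross a b = 0"
  then obtain c where "b = c *s a" using cross_eq_0_imp_scale by blast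
  then show "lin a dvd lin b" by (simp add: lin_hom)
next
  assume "a \<noteq> 0" "lin a dvd lin b"
  then obtain r where r: "lin b = lin a * r" by (auto simp: dvd_def)
  have "dot c (cross a b) = 0" for c
  proof (cases "cross c a = 0")
    case True then show ?thesis by (simp add: dot_cross_rotate[symmetric] dot_cross_rotate[of b] dot_simps)
  next
    case False
    have "lin b \<in> ideal2 (lin c) (lin a)" by (rule ideal2I[of _ _ 0 _ r]) (simp add: r)
    with lin_in_point_ideal_iff[OF False] show ?thesis by (metis dot_cross_rotate)
  qed
  then show "cross a b = 0" using exists_dot_neq_0 by blast
qed

section \<open>Minimal generators and their degrees\<close>

definition has_min_gens :: "(poly3 ^ 3) set \<Rightarrow> nat list \<Rightarrow> bool" where
  "has_min_gens M es \<longleftrightarrow> (\<exists>gs. distinct gs \<and> list_all2 homogeneous_triple es gs \<and>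
     minimal_generating_set M (set gs))"

lemma hom_part_0: "hom_part 0 p = const3 (const_term p)"
  by (rule poly_mapping_eqI) (auto simp: lookup_hom_part const3_def lookup_single when_def monom_deg_0_iff)

lemma hom_part_mult_less:
  assumes "homogeneous k p" "l < k" shows "hom_part l (p * q) = 0"
proof (induction q rule: poly3_monomial_induct)
  case (single m c)
  have "homogeneous (monom_deg m) (Poly_Mapping.single m c)"
    by (simp add: homogeneous_iff lookup_single when_def)
  from homogeneous_mult[OF assms(1) this] show ?case
    by (rule hom_part_homogeneous_other) (use assms(2) in simp)
qed (simp add: hom_part_add algebra_simps)

lemma sum_over_set_as_list:
  assumes "distinct gs"
  shows "(\<Sum>v\<in>set gs. f v) = (\<Sum>i<length gs. f (gs ! i))"
  using assms by (simp add: sum.distinct_set_conv_list sum_list_sum_nth atLeast0LessThan)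

text \<open>
  If a proper subset of the generators spanned the module, one of the generators would be a
  combination of the others.  This is a relation with a coefficient \<open>-1\<close>, whose constant term does not
  vanish; so it is enough that the coefficients of all relations lie in the maximal ideal.
\<close>

lemma has_min_gensI:
  assumes deg: "list_all2 homogeneous_triple es gs"
    and gen: "\<And>g. g \<in> M \<longleftrightarrow> (\<exists>c. g = (\<Sum>i<length gs. c i *s gs ! i))"
    and min: "\<And>c. (\<Sum>i<length gs. c i *s gs ! i) = 0 \<Longrightarrow> \<forall>i<length gs. const_term (c i) = 0"
  shows "has_min_gens M es"
proof -
  have dist: "distinct gs"
    unfolding distinct_conv_nth
  proof (intro allI impI notI)
    fix i j assume ij: "i < length gs" "j < length gs" "i \<noteq> j" "gs ! i = gs ! j"
    define c :: "nat \<Rightarrow> poly3" where "c = (\<lambda>k. if k = i then 1 else if k = j then -1 else 0)"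
    have "(\<Sum>k<length gs. c k *s gs ! k) = (\<Sum>k\<in>{i, j}. c k *s gs ! k)"
      by (rule sum.mono_neutral_right) (use ij in \<open>auto simp: c_def\<close>)
    also have "\<dots> = 0" using ij by (simp add: c_def)
    finally have "const_term (c i) = 0" using min ij by blast
    then show False by (simp add: c_def)
  qed
  have span: "syz.span (set gs) = M"
    unfolding syz.span_finite[OF finite_set] gen set_eq_iff sum_over_set_as_list[OF dist]
  proof safe
    fix u show "\<exists>c. (\<Sum>i<length gs. u (gs ! i) *s gs ! i) = (\<Sum>i<length gs. c i *s gs ! i)"
      by (rule exI[of _ "\<lambda>i. u (gs ! i)"]) simp
  next
    fix c :: "nat \<Rightarrow> poly3"
    have "(\<Sum>i<length gs. c i *s gs ! i) =
        (\<Sum>i<length gs. c (the_inv_into {..<length gs} ((!) gs) (gs ! i)) *s gs ! i)"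
      using dist by (intro sum.cong) (auto simp: the_inv_into_f_f inj_on_def nth_eq_iff_index_eq)
    then show "(\<Sum>i<length gs. c i *s gs ! i) \<in> range (\<lambda>u. \<Sum>i<length gs. u (gs ! i) *s gs ! i)"
      by (intro range_eqI[of _ _ "\<lambda>g. c (the_inv_into {..<length gs} ((!) gs) g)"]) simp
  qed
  have "syz.span H \<noteq> M" if H: "H \<subset> set gs" for H
  proof
    assume HM: "syz.span H = M"
    obtain k where k: "k < length gs" "gs ! k \<notin> H" using H by (metis in_set_conv_nth psubset_imp_ex_mem DiffE)
    have "finite H" using H finite_subset by blast
    have "gs ! k \<in> syz.span H" using HM span k(1) by (metis nth_mem syz.span_base)
    then obtain r where r: "gs ! k = (\<Sum>h\<in>H. r h *s h)" using syz.span_finite[OF \<open>finite H\<close>] by auto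
    define c where "c i = (if i = k then -1 else if gs ! i \<in> H then r (gs ! i) else 0)" for i
    have "(\<Sum>h\<in>H. r h *s h) = (\<Sum>v\<in>set gs. (if v \<in> H then r v else 0) *s v)"
      using H by (intro sum.mono_neutral_cong_left) auto
    also have "\<dots> = (\<Sum>i<length gs. (if gs ! i \<in> H then r (gs ! i) else 0) *s gs ! i)"
      by (rule sum_over_set_as_list[OF dist])
    also have "\<dots> = (\<Sum>i<length gs. c i *s gs ! i + (if i = k then gs ! k else 0))"
      using k by (intro sum.cong) (auto simp: c_def)
    also have "\<dots> = (\<Sum>i<length gs. c i *s gs ! i) + gs ! k"
      using k(1) by (simp add: sum.distrib)
    finally have "(\<Sum>i<length gs. c i *s gs ! i) = 0" using r by simp
    then have "const_term (c k) = 0" using min k by blast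
    then show False by (simp add: c_def)
  qed
  then show ?thesis using dist deg span unfolding has_min_gens_def minimal_generating_set_def by blast
qed

text \<open>
  Membership of a conic is witnessed by linear forms: take homogeneous components of any witnesses.
\<close>

lemma homogeneous_ideal2:
  assumes "q \<in> ideal2 L M" "homogeneous 2 q" "homogeneous 1 L" "homogeneous 1 M"
  obtains u v where "q = L * u + M * v" "homogeneous (Suc 0) u" "homogeneous (Suc 0) v"
proof -
  obtain u v where q: "q = L * u + M * v" using assms(1) by (rule ideal2E)
  have "hom_part (1 + 1) q = L * hom_part 1 u + M * hom_part 1 v"
    unfolding q hom_part_add hom_part_mult[OF assms(3)] hom_part_mult[OF assms(4)] ..
  then have "q = L * hom_part 1 u + M * hom_part 1 v"
    using hom_part_homogeneous[OF assms(2)] by (simp only: one_add_one)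
  then show ?thesis by (rule that) simp_all
qed

lemma const_term_eq_0_if_dvd:
  assumes "l dvd r" "homogeneous 1 l" shows "const_term r = 0"
  using assms const_term_homogeneous[OF assms(2)] by (auto simp: dvd_def const_term_mult)

text \<open>
  In a relation the form \<open>l\<close>, which is prime to \<open>m\<close>, divides \<open>r1\<close>, and the factor \<open>n\<close> of \<open>m\<close>, to which \<open>l\<close>
  is prime, divides \<open>r0\<close>; so both coefficients vanish at the origin.
\<close>

lemma two_term_relation:
  assumes "r0 * l + r1 * m = 0" and "homogeneous 1 l" "homogeneous 1 n"
    and "\<And>q. l dvd m * q \<Longrightarrow> l dvd q" and "\<And>q. n dvd l * q \<Longrightarrow> n dvd q" and "n dvd m"
  shows "const_term r0 = 0 \<and> const_term r1 = 0"
proof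
  have "m * r1 = l * (- r0)" "l * r0 = m * (- r1)"
    using assms(1) by (simp_all add: mult.commute add_eq_0_iff add_eq_0_iff2)
  then have "l dvd m * r1" "m dvd l * r0" by (metis dvd_triv_left)+
  with assms(6) have "n dvd l * r0" by (metis dvd_trans)
  with \<open>l dvd m * r1\<close> assms(4,5) have "l dvd r1" "n dvd r0" by blast+
  then show "const_term r0 = 0" "const_term r1 = 0" using const_term_eq_0_if_dvd assms by blast+
qed

lemma less_2_3: "i < (2::nat) \<longleftrightarrow> i = 0 \<or> i = 1" "i < (3::nat) \<longleftrightarrow> i = 0 \<or> i = 1 \<or> i = 2"
  by auto

lemma sum_less_2_3:
  "(\<Sum>i<(2::nat). h i) = h 0 + h 1" "(\<Sum>i<(3::nat). h i) = h 0 + h 1 + (h 2 :: poly3)" for h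
  by (simp_all add: numeral_2_eq_2 numeral_3_eq_3)

lemma homogeneous_prods:
  "homogeneous (Suc 0) l \<Longrightarrow> homogeneous (Suc 0) m \<Longrightarrow> homogeneous 2 (l * m)"
  "homogeneous (Suc 0) l \<Longrightarrow> homogeneous 2 q \<Longrightarrow> homogeneous 3 (l * q)"
  "homogeneous 2 q \<Longrightarrow> homogeneous (Suc 0) l \<Longrightarrow> homogeneous 3 (q * l)"
  by (erule (1) homogeneous_mult', simp)+

section \<open>Syzygies of six lines with a triple point\<close>

definition deriv_along :: "poly3 ^ 3 \<Rightarrow> poly3 \<Rightarrow> poly3" where
  "deriv_along g p = (\<Sum>i\<in>UNIV. g $ i * pdv i p)"

lemma AR_iff: "g \<in> AR f \<longleftrightarrow> deriv_along g f = 0"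
  by (simp add: AR_def deriv_along_def)

lemma deriv_along_mult: "deriv_along g (p * q) = deriv_along g p * q + p * deriv_along g q"
  by (simp add: deriv_along_def pdv_mult algebra_simps sum.distrib sum_distrib_left)

lemma deriv_along_lin_add:
  "deriv_along g (lin (a + b)) = deriv_along g (lin a) + deriv_along g (lin b)"
  "deriv_along g (lin (k *s a)) = const3 k * deriv_along g (lin a)"
  by (simp_all add: deriv_along_def lin_hom pdv_add pdv_mult pdv_const algebra_simps sum.distrib sum_distrib_left)

text \<open>
  A derivation annihilating \<open>f\<close> is tangent to each line that occurs in \<open>f\<close> with multiplicity one: by the
  Leibniz rule \<open>lin a\<close> divides \<open>D (lin a) * r\<close>.
\<close>

lemma dvd_deriv_along:
  assumes "a \<noteq> 0" "f = lin a * r" "deriv_along g f = 0" "\<not> lin a dvd r"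
  shows "lin a dvd deriv_along g (lin a)"
proof -
  have "deriv_along g (lin a) * r = lin a * (- deriv_along g r)"
    using assms(2,3) by (simp add: deriv_along_mult eq_neg_iff_add_eq_0)
  then have "lin a dvd deriv_along g (lin a) * r" by simp
  with lin_prime[OF assms(1)] assms(4) show ?thesis by blast
qed

text \<open>
  The normal form of the arrangement: the triple point is the common zero of \<open>a\<close> and \<open>b\<close>, the lines
  through it are \<open>a\<close>, \<open>b\<close> and \<open>a + b\<close>, and the other three lines are scaled so that their third
  coordinate with respect to \<open>a, b, c\<close> is 1.
\<close>

locale triple_point_lines =
  fixes a b c du dv dw :: "complex ^ 3" and s t s' t' :: complex
  assumes indep: "dot c (cross a b) \<noteq> 0"
    and dual: "dual_bases a b c du dv dw"
    and XY_distinct: "cross c (c + (s *s a + t *s b)) \<noteq> 0"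
    and XZ_distinct: "cross c (c + (s' *s a + t' *s b)) \<noteq> 0"
    and YZ_distinct: "cross (c + (s *s a + t *s b)) (c + (s' *s a + t' *s b)) \<noteq> 0"
begin

abbreviation "cY \<equiv> c + (s *s a + t *s b)"
abbreviation "cZ \<equiv> c + (s' *s a + t' *s b)"

definition "x = lin a"
definition "y = lin b"
definition "w = lin (a + b)"
definition "X = lin c"
definition "Y = lin cY"
definition "Z = lin cZ"
definition "f = x * y * w * X * Y * Z"

text \<open>
  The derivation that maps \<open>x\<close> to \<open>x w\<close> and annihilates \<open>y\<close> and \<open>X\<close> is tangent to the lines \<open>x\<close>, \<open>y\<close>, \<open>w\<close>
  and \<open>X\<close>; it maps \<open>Y\<close> to the conic \<open>d\<close> and \<open>Z\<close> to the conic \<open>d'\<close>.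
\<close>

definition "d = const3 s * x * w"
definition "d' = const3 s' * x * w"

lemmas line_defs = x_def y_def w_def X_def Y_def Z_def

lemma w_eq: "w = x + y" and Y_eq: "Y = X + const3 s * x + const3 t * y"
  and Z_eq: "Z = X + const3 s' * x + const3 t' * y"
  by (simp_all add: line_defs lin_hom algebra_simps)

lemma ab: "cross a b \<noteq> 0"
  using indep by (auto simp: dot_simps)

lemma cross_neq:
  "cross a b \<noteq> 0" "cross b a \<noteq> 0" "cross a (a + b) \<noteq> 0" "cross b (a + b) \<noteq> 0"
  "cross (a + b) a \<noteq> 0" "cross (a + b) b \<noteq> 0"
  using ab cross_commute[of a b] by (auto simp: cross_add)

lemma cross_neq_off_P:
  assumes "dot m (cross a b) = 0" "m \<noteq> 0" "dot l (cross a b) \<noteq> 0"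
  shows "cross m l \<noteq> 0" "cross l m \<noteq> 0"
proof -
  show "cross m l \<noteq> 0" using cross_eq_0_imp_scale[of m l] assms by (auto simp: dot_simps)
  then show "cross l m \<noteq> 0" using cross_commute[of m l] by auto
qed

lemma neq0: "a \<noteq> 0" "b \<noteq> 0" "a + b \<noteq> 0" "c \<noteq> 0" "cY \<noteq> 0" "cZ \<noteq> 0"
proof -
  have z: "cross 0 v = 0" "cross v 0 = 0" for v by (simp_all add: vec3_simps)
  show "a \<noteq> 0" "b \<noteq> 0" "a + b \<noteq> 0" "c \<noteq> 0" using cross_neq XY_distinct z by metis+
  show "cY \<noteq> 0" using XY_distinct z by metis
  show "cZ \<noteq> 0" using XZ_distinct z by metis
qed

lemma dot_P: "dot a (cross a b) = 0" "dot b (cross a b) = 0" "dot (a + b) (cross a b) = 0"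
  "dot cY (cross a b) \<noteq> 0" "dot cZ (cross a b) \<noteq> 0"
  using indep by (simp_all add: dot_simps dot_cross_self)

lemma cross_distinct: "cross cY c \<noteq> 0" "cross cZ c \<noteq> 0" "cross cZ cY \<noteq> 0"
  using XY_distinct XZ_distinct YZ_distinct
    cross_commute[of c cY] cross_commute[of c cZ] cross_commute[of cY cZ] by auto

lemma lines_neq_0: "x \<noteq> 0" "y \<noteq> 0" "w \<noteq> 0" "X \<noteq> 0" "Y \<noteq> 0" "Z \<noteq> 0"
  unfolding line_defs lin_eq_0_iff by (rule neq0)+

lemma f_neq_0: "f \<noteq> 0"
  by (simp add: f_def lines_neq_0)

lemma primes:
  "x dvd p * q \<longleftrightarrow> x dvd p \<or> x dvd q" "y dvd p * q \<longleftrightarrow> y dvd p \<or> y dvd q"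
  "w dvd p * q \<longleftrightarrow> w dvd p \<or> w dvd q" "X dvd p * q \<longleftrightarrow> X dvd p \<or> X dvd q"
  "Y dvd p * q \<longleftrightarrow> Y dvd p \<or> Y dvd q" "Z dvd p * q \<longleftrightarrow> Z dvd p \<or> Z dvd q"
  unfolding line_defs by (meson lin_prime neq0 dvd_mult dvd_mult2)+

lemma not_dvd:
  "\<not> x dvd y" "\<not> x dvd w" "\<not> x dvd X" "\<not> x dvd Y" "\<not> x dvd Z"
  "\<not> y dvd x" "\<not> y dvd w" "\<not> y dvd X" "\<not> y dvd Y" "\<not> y dvd Z"
  "\<not> w dvd x" "\<not> w dvd y" "\<not> w dvd X" "\<not> w dvd Y" "\<not> w dvd Z"
  "\<not> X dvd x" "\<not> X dvd y" "\<not> X dvd w" "\<not> X dvd Y" "\<not> X dvd Z"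
  "\<not> Y dvd x" "\<not> Y dvd y" "\<not> Y dvd w" "\<not> Y dvd X" "\<not> Y dvd Z"
  "\<not> Z dvd x" "\<not> Z dvd y" "\<not> Z dvd w" "\<not> Z dvd X" "\<not> Z dvd Y"
  unfolding line_defs lin_dvd_lin_iff[OF neq0(1)] lin_dvd_lin_iff[OF neq0(2)] lin_dvd_lin_iff[OF neq0(3)]
    lin_dvd_lin_iff[OF neq0(4)] lin_dvd_lin_iff[OF neq0(5)] lin_dvd_lin_iff[OF neq0(6)]
  by (rule cross_neq cross_neq_off_P XY_distinct XZ_distinct YZ_distinct cross_distinct
      dot_P neq0 indep)+

lemma hom1: "homogeneous 1 x" "homogeneous 1 y" "homogeneous 1 w"
    "homogeneous 1 X" "homogeneous 1 Y" "homogeneous 1 Z"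
  unfolding line_defs by (rule homogeneous_lin)+

lemma hom2: "homogeneous 2 d" "homogeneous 2 d'"
  unfolding d_def d'_def by (rule homogeneous_mult'[OF homogeneous_const_mult]; (rule hom1)?; simp)+

section \<open>The linear parametrisation of the syzygies\<close>

text \<open>
  These relations say that the derivation with \<open>x \<mapsto> x w p\<close>, \<open>y \<mapsto> 0\<close> and \<open>X \<mapsto> X b1\<close> maps \<open>Y\<close> to \<open>Y b2\<close>
  and \<open>Z\<close> to \<open>Z b3\<close>, that is, that it is tangent to all six lines.
\<close>

definition compatible :: "poly3 \<Rightarrow> poly3 \<Rightarrow> poly3 \<Rightarrow> poly3 \<Rightarrow> bool" where
  "compatible p b1 b2 b3 \<longleftrightarrow> Y * b2 = X * b1 + d * p \<and> Z * b3 = X * b1 + d' * p"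

text \<open>
  The Euler derivation has the cofactor 1 on each of the six lines.  Adding this multiple of it makes
  the cofactors \<open>w p\<close>, \<open>0\<close>, \<open>x p\<close>, \<open>b1\<close>, \<open>b2\<close>, \<open>b3\<close> add up to 0.
\<close>

definition euler_coeff where
  "euler_coeff p b1 b2 b3 = const3 (-1/6) * ((w + x) * p + b1 + b2 + b3)"

text \<open>
  The triple is given by its values \<open>x (w p + e)\<close>, \<open>y e\<close> and \<open>X (b1 + e)\<close> on the forms \<open>x\<close>, \<open>y\<close> and \<open>X\<close>,
  from which the dual basis recovers its components.
\<close>

definition syzygy :: "poly3 \<Rightarrow> poly3 \<Rightarrow> poly3 \<Rightarrow> poly3 \<Rightarrow> poly3 ^ 3" where
  "syzygy p b1 b2 b3 = (let e = euler_coeff p b1 b2 b3 in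
     \<chi> i. const3 (du $ i) * (x * (w * p + e)) + const3 (dv $ i) * (y * e)
        + const3 (dw $ i) * (X * (b1 + e)))"

lemma deriv_along_combination:
  "deriv_along (\<chi> i. const3 (du $ i) * A + const3 (dv $ i) * B + const3 (dw $ i) * C) (lin z) =
     const3 (dot z du) * A + const3 (dot z dv) * B + const3 (dot z dw) * C"
  by (simp add: deriv_along_def pdv_lin dot_def sum_3 const3_hom algebra_simps)

lemma deriv_along_recover:
  "g = (\<chi> i. const3 (du $ i) * deriv_along g x + const3 (dv $ i) * deriv_along g y
          + const3 (dw $ i) * deriv_along g X)"
proof -
  have "g $ i = const3 (du $ i) * deriv_along g x + const3 (dv $ i) * deriv_along g y
          + const3 (dw $ i) * deriv_along g X" for i
  proof -
    have "g $ i = (\<Sum>j\<in>UNIV. g $ j * const3 (if j = i then 1 else 0))"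
      by (simp add: if_distrib[of const3] if_distrib[of "\<lambda>x. _ * x"] cong: if_cong)
    also have "\<dots> = (\<Sum>j\<in>UNIV. g $ j * const3 (a $ j * du $ i + b $ j * dv $ i + c $ j * dw $ i))"
      using dual unfolding dual_bases_def by simp
    also have "\<dots> = const3 (du $ i) * deriv_along g x + const3 (dv $ i) * deriv_along g y
          + const3 (dw $ i) * deriv_along g X"
      by (simp add: deriv_along_def line_defs pdv_lin sum_3 const3_hom algebra_simps)
    finally show ?thesis .
  qed
  then show ?thesis by (simp add: vec_eq_iff)
qed

lemma deriv_along_syzygy:
  fixes p b1 b2 b3
  defines "g \<equiv> syzygy p b1 b2 b3" and "e \<equiv> euler_coeff p b1 b2 b3"
  shows "deriv_along g x = x * (w * p + e)" "deriv_along g y = y * e" "deriv_along g X = X * (b1 + e)"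
  using dual
  by (simp_all add: g_def syzygy_def Let_def line_defs deriv_along_combination dual_bases_def
      flip: e_def)

lemma deriv_along_lines:
  "deriv_along g w = deriv_along g x + deriv_along g y"
  "deriv_along g Y = deriv_along g X + const3 s * deriv_along g x + const3 t * deriv_along g y"
  "deriv_along g Z = deriv_along g X + const3 s' * deriv_along g x + const3 t' * deriv_along g y"
  by (simp_all add: line_defs deriv_along_lin_add)

lemma deriv_along_f:
  assumes "deriv_along g x = x * a1" "deriv_along g y = y * a2" "deriv_along g w = w * a3"
    "deriv_along g X = X * a4" "deriv_along g Y = Y * a5" "deriv_along g Z = Z * a6"
  shows "deriv_along g f = f * (a1 + a2 + a3 + a4 + a5 + a6)"
  unfolding f_def by (simp add: deriv_along_mult assms algebra_simps)

lemma syzygy_in_AR: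
  assumes "compatible p b1 b2 b3" shows "syzygy p b1 b2 b3 \<in> AR f"
proof -
  define e where "e = euler_coeff p b1 b2 b3"
  note D = deriv_along_syzygy[of p b1 b2 b3, folded e_def]
  have K: "Y * b2 = X * b1 + d * p" "Z * b3 = X * b1 + d' * p"
    using assms by (simp_all add: compatible_def)
  have w: "deriv_along (syzygy p b1 b2 b3) w = w * (x * p + e)"
    unfolding deriv_along_lines D by (simp add: w_eq algebra_simps)
  have "deriv_along (syzygy p b1 b2 b3) Y = (X * b1 + d * p) + Y * e"
    unfolding deriv_along_lines D by (simp add: Y_eq d_def algebra_simps)
  then have Y: "deriv_along (syzygy p b1 b2 b3) Y = Y * (b2 + e)"
    unfolding K(1)[symmetric] by (simp add: algebra_simps)
  have "deriv_along (syzygy p b1 b2 b3) Z = (X * b1 + d' * p) + Z * e"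
    unfolding deriv_along_lines D by (simp add: Z_eq d'_def algebra_simps)
  then have Z: "deriv_along (syzygy p b1 b2 b3) Z = Z * (b3 + e)"
    unfolding K(2)[symmetric] by (simp add: algebra_simps)
  have "6 * e = - ((w + x) * p + b1 + b2 + b3)"
  proof -
    have "6 * e = const3 (6 * (-1/6)) * ((w + x) * p + b1 + b2 + b3)"
      unfolding e_def euler_coeff_def const3_hom by (simp add: const3_def algebra_simps)
    then show ?thesis by (simp add: const3_hom)
  qed
  then have "(w * p + e) + e + (x * p + e) + (b1 + e) + (b2 + e) + (b3 + e) = 0"
    by (simp add: algebra_simps)
  then show ?thesis
    using deriv_along_f[OF D(1,2) w D(3) Y Z] by (simp add: AR_iff)
qed

text \<open>
  A syzygy has a cofactor on each line.  Those of \<open>x\<close>, \<open>y\<close> and \<open>w\<close> are linked by \<open>w = x + y\<close>: the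
  difference of the first two is divisible by \<open>w\<close>, and the quotient is \<open>p\<close>.
\<close>

lemma AR_is_syzygy:
  assumes "g \<in> AR f"
  shows "\<exists>p b1 b2 b3. compatible p b1 b2 b3 \<and> g = syzygy p b1 b2 b3"
proof -
  have D0: "deriv_along g f = 0" using assms by (simp add: AR_iff)
  have "x dvd deriv_along g x"
    unfolding x_def
    by (rule dvd_deriv_along[OF neq0(1) _ D0, of "y * w * X * Y * Z"])
       (simp_all add: f_def primes not_dvd algebra_simps flip: x_def)
  then obtain a1 where a1: "deriv_along g x = x * a1" by (auto simp: dvd_def)
  have "y dvd deriv_along g y"
    unfolding y_def
    by (rule dvd_deriv_along[OF neq0(2) _ D0, of "x * w * X * Y * Z"])
       (simp_all add: f_def primes not_dvd algebra_simps flip: y_def)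
  then obtain a2 where a2: "deriv_along g y = y * a2" by (auto simp: dvd_def)
  have "w dvd deriv_along g w"
    unfolding w_def
    by (rule dvd_deriv_along[OF neq0(3) _ D0, of "x * y * X * Y * Z"])
       (simp_all add: f_def primes not_dvd algebra_simps flip: w_def)
  then obtain a3 where a3: "deriv_along g w = w * a3" by (auto simp: dvd_def)
  have "X dvd deriv_along g X"
    unfolding X_def
    by (rule dvd_deriv_along[OF neq0(4) _ D0, of "x * y * w * Y * Z"])
       (simp_all add: f_def primes not_dvd algebra_simps flip: X_def)
  then obtain a4 where a4: "deriv_along g X = X * a4" by (auto simp: dvd_def)
  have "Y dvd deriv_along g Y"
    unfolding Y_def
    by (rule dvd_deriv_along[OF neq0(5) _ D0, of "x * y * w * X * Z"])
       (simp_all add: f_def primes not_dvd algebra_simps flip: Y_def)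
  then obtain a5 where a5: "deriv_along g Y = Y * a5" by (auto simp: dvd_def)
  have "Z dvd deriv_along g Z"
    unfolding Z_def
    by (rule dvd_deriv_along[OF neq0(6) _ D0, of "x * y * w * X * Y"])
       (simp_all add: f_def primes not_dvd algebra_simps flip: Z_def)
  then obtain a6 where a6: "deriv_along g Z = Z * a6" by (auto simp: dvd_def)
  have "f * (a1 + a2 + a3 + a4 + a5 + a6) = 0"
    using deriv_along_f[OF a1 a2 a3 a4 a5 a6] D0 by simp
  then have sum0: "a1 + a2 + a3 + a4 + a5 + a6 = 0" using f_neq_0 by simp
  have w3: "w * a3 = x * a1 + y * a2" using deriv_along_lines(1)[of g] by (simp add: a1 a2 a3)
  then have xa: "x * (a1 - a2) = w * (a3 - a2)" by (simp add: w_eq algebra_simps)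
  then have "w dvd x * (a1 - a2)" by simp
  then have "w dvd a1 - a2" using primes not_dvd by blast
  then obtain p where p: "a1 - a2 = w * p" by (auto simp: dvd_def)
  then have a1': "a1 = a2 + w * p" by (simp add: algebra_simps)
  have "w * (x * p) = w * (a3 - a2)" using xa p by (simp add: algebra_simps)
  then have "x * p = a3 - a2" using lines_neq_0(3) by (metis mult_left_cancel)
  then have a3': "a3 = a2 + x * p" by simp
  define b1 b2 b3 where b: "b1 = a4 - a2" "b2 = a5 - a2" "b3 = a6 - a2"
  have "Y * a5 = X * a4 + const3 s * (x * a1) + const3 t * (y * a2)"
    using deriv_along_lines(2)[of g] by (simp add: a1 a2 a4 a5)
  then have K1: "Y * b2 = X * b1 + d * p"
    unfolding b a1' by (simp add: Y_eq d_def algebra_simps)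
  have "Z * a6 = X * a4 + const3 s' * (x * a1) + const3 t' * (y * a2)"
    using deriv_along_lines(3)[of g] by (simp add: a1 a2 a4 a6)
  then have K2: "Z * b3 = X * b1 + d' * p"
    unfolding b a1' by (simp add: Z_eq d'_def algebra_simps)
  have "(w + x) * p + b1 + b2 + b3 = - 6 * a2"
  proof -
    have "(w + x) * p + b1 + b2 + b3 = (a1 + a2 + a3 + a4 + a5 + a6) - 6 * a2"
      unfolding b a1' a3' by (simp add: algebra_simps)
    then show ?thesis by (simp add: sum0)
  qed
  then have "euler_coeff p b1 b2 b3 = const3 (-1/6) * (- const3 6 * a2)"
    unfolding euler_coeff_def by (simp add: const3_def)
  also have "\<dots> = const3 ((-1/6) * (-6)) * a2" by (simp add: const3_hom mult.assoc flip: const3_hom)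
  finally have e: "euler_coeff p b1 b2 b3 = a2" by simp
  have a4': "a4 = b1 + a2" by (simp add: b)
  have "g = syzygy p b1 b2 b3"
    by (subst deriv_along_recover[of g])
       (simp add: syzygy_def Let_def e a1 a2 a4 a1' a4' algebra_simps)
  with K1 K2 show ?thesis unfolding compatible_def by blast
qed

lemma syzygy_add:
  "syzygy (p + p') (b1 + b1') (b2 + b2') (b3 + b3') = syzygy p b1 b2 b3 + syzygy p' b1' b2' b3'"
  by (simp add: syzygy_def euler_coeff_def Let_def vec_eq_iff algebra_simps)

lemma syzygy_scale: "syzygy (r * p) (r * b1) (r * b2) (r * b3) = r *s syzygy p b1 b2 b3"
  by (simp add: syzygy_def euler_coeff_def Let_def vec_eq_iff algebra_simps)

lemma syzygy_0: "syzygy 0 0 0 0 = 0"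
  by (simp add: syzygy_def euler_coeff_def Let_def vec_eq_iff)

lemma syzygy_sum:
  "(\<Sum>i\<in>I. r i *s syzygy (P i) (B1 i) (B2 i) (B3 i)) =
     syzygy (\<Sum>i\<in>I. r i * P i) (\<Sum>i\<in>I. r i * B1 i) (\<Sum>i\<in>I. r i * B2 i) (\<Sum>i\<in>I. r i * B3 i)"
  by (induction I rule: infinite_finite_induct) (simp_all add: syzygy_0 syzygy_add syzygy_scale)

lemma compatible_add:
  "compatible p b1 b2 b3 \<Longrightarrow> compatible p' b1' b2' b3' \<Longrightarrow>
   compatible (p + p') (b1 + b1') (b2 + b2') (b3 + b3')"
  by (simp add: compatible_def algebra_simps)

lemma compatible_scale:
  assumes "compatible p b1 b2 b3" shows "compatible (r * p) (r * b1) (r * b2) (r * b3)"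
proof -
  have "Y * (r * b2) = r * (Y * b2)" "Z * (r * b3) = r * (Z * b3)" by simp_all
  then show ?thesis using assms unfolding compatible_def by (simp only:) (simp add: algebra_simps)
qed

lemma compatible_sum:
  assumes "\<And>i. i \<in> I \<Longrightarrow> compatible (P i) (B1 i) (B2 i) (B3 i)"
  shows "compatible (\<Sum>i\<in>I. r i * P i) (\<Sum>i\<in>I. r i * B1 i) (\<Sum>i\<in>I. r i * B2 i) (\<Sum>i\<in>I. r i * B3 i)"
  using assms
proof (induction I rule: infinite_finite_induct)
  case (insert i I)
  then show ?case by (simp add: compatible_add compatible_scale)
qed (simp_all add: compatible_def)

lemma syzygy_eq_0_imp:
  assumes K: "compatible p b1 b2 b3" and z: "syzygy p b1 b2 b3 = 0"
  shows "p = 0 \<and> b1 = 0 \<and> b2 = 0 \<and> b3 = 0"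
proof -
  define e where "e = euler_coeff p b1 b2 b3"
  note D = deriv_along_syzygy[of p b1 b2 b3, folded e_def]
  have 0: "deriv_along 0 q = 0" for q by (simp add: deriv_along_def)
  have "e = 0" using D(2) z lines_neq_0 0 by simp
  moreover then have "p = 0" using D(1) z lines_neq_0 0 by simp
  moreover have "b1 = 0" using D(3) z lines_neq_0 0 \<open>e = 0\<close> by simp
  ultimately show ?thesis using K lines_neq_0 by (simp add: compatible_def)
qed

lemma compatible_0:
  assumes "compatible 0 b1 b2 b3"
  obtains r where "b1 = r * (Y * Z)" "b2 = r * (X * Z)" "b3 = r * (X * Y)"
proof -
  have e: "Y * b2 = X * b1" "Z * b3 = X * b1" using assms by (simp_all add: compatible_def)
  then have "Y dvd X * b1" "Z dvd X * b1" by (metis dvd_triv_left)+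
  then have "Y dvd b1" "Z dvd b1" by (simp_all add: primes not_dvd)
  then obtain q where q: "b1 = Y * q" by (auto simp: dvd_def)
  with \<open>Z dvd b1\<close> have "Z dvd q" by (simp add: primes not_dvd)
  then obtain r where r: "q = Z * r" by (auto simp: dvd_def)
  have b1: "b1 = r * (Y * Z)" by (simp add: q r)
  have "Y * b2 = Y * (r * (X * Z))" "Z * b3 = Z * (r * (X * Y))"
    using e by (simp_all add: b1 algebra_simps)
  then have "b2 = r * (X * Z)" "b3 = r * (X * Y)"
    using lines_neq_0 by (metis mult_left_cancel)+
  with b1 show ?thesis by (rule that)
qed

lemma compatible_line_product: "compatible 0 (Y * Z) (X * Z) (X * Y)"
  by (simp add: compatible_def algebra_simps)

text \<open>
  The relations are homogeneous, so a solution with homogeneous \<open>p\<close> yields one that is homogeneous in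
  all components.
\<close>

lemma compatible_hom_part:
  assumes "compatible p b1 b2 b3" "homogeneous k p"
  shows "compatible p (hom_part (Suc k) b1) (hom_part (Suc k) b2) (hom_part (Suc k) b3)"
proof -
  have l: "hom_part (Suc (Suc k)) (l * b) = l * hom_part (Suc k) b" if "homogeneous 1 l" for l b
    using hom_part_mult[OF that, of "Suc k"] by simp
  have e: "hom_part (Suc (Suc k)) (e * p) = e * p" if "homogeneous 2 e" for e
    by (rule hom_part_homogeneous) (use homogeneous_mult[OF that assms(2)] in simp)
  show ?thesis
    using arg_cong[where f = "hom_part (Suc (Suc k))", of "Y * b2" "X * b1 + d * p"]
      arg_cong[where f = "hom_part (Suc (Suc k))", of "Z * b3" "X * b1 + d' * p"] assms(1)
    unfolding compatible_def hom_part_add e[OF hom2(1)] e[OF hom2(2)]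
      l[OF hom1(4)] l[OF hom1(5)] l[OF hom1(6)] by blast
qed

lemma homogeneous_syzygy:
  assumes "homogeneous k p" "homogeneous (Suc k) b1" "homogeneous (Suc k) b2" "homogeneous (Suc k) b3"
  shows "homogeneous_triple (k + 2) (syzygy p b1 b2 b3)"
proof -
  have lin: "homogeneous (Suc k) (l * p)" if "homogeneous 1 l" for l
    using homogeneous_mult[OF that assms(1)] by simp
  have e: "homogeneous (Suc k) (euler_coeff p b1 b2 b3)"
    unfolding euler_coeff_def
    by (intro homogeneous_const_mult homogeneous_add lin hom1 assms)
  have lin2: "homogeneous (Suc (Suc k)) (l * q)" if "homogeneous 1 l" "homogeneous (Suc k) q" for l q
    using homogeneous_mult[OF that] by simp
  show ?thesis
    unfolding homogeneous_triple_def syzygy_def Let_def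
    by (simp, intro allI homogeneous_add homogeneous_const_mult lin2 hom1 assms e lin)
qed

section \<open>From generators of the ideal to generators of the syzygies\<close>

text \<open>
  Projecting a solution to \<open>p\<close> maps the syzygies onto the ideal \<open>I\<close>, with a kernel generated by the
  syzygy of degree 3; so lifts of generators of \<open>I\<close> generate together with it.  In a relation, the
  coefficients of the lifts have no constant term because the generators of \<open>I\<close> are minimal.  The
  second component of the relation, taken in degree 2, then only contains \<open>Y Z\<close> times the constant term
  of the remaining coefficient: the lifts contribute nothing since their second components have degree
  at least 2.
\<close>

lemma min_gens_from_ideal:
  assumes K: "\<And>i. i < n \<Longrightarrow> compatible (P i) (B1 i) (B2 i) (B3 i)"
    and deg: "\<And>i. i < n \<Longrightarrow> E i \<ge> 1 \<and> homogeneous (E i) (P i)"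
      "\<And>i. i < n \<Longrightarrow> homogeneous (Suc (E i)) (B1 i)"
      "\<And>i. i < n \<Longrightarrow> homogeneous (Suc (E i)) (B2 i)"
      "\<And>i. i < n \<Longrightarrow> homogeneous (Suc (E i)) (B3 i)"
    and gen: "\<And>p b1 b2 b3. compatible p b1 b2 b3 \<Longrightarrow> \<exists>r. p = (\<Sum>i<n. r i * P i)"
    and min: "\<And>r. (\<Sum>i<n. r i * P i) = 0 \<Longrightarrow> \<forall>i<n. const_term (r i) = 0"
  shows "has_min_gens (AR f) (3 # map (\<lambda>i. E i + 2) [0..<n])"
proof -
  define G where "G i = syzygy (P i) (B1 i) (B2 i) (B3 i)" for i
  define gs where "gs = syzygy 0 (Y * Z) (X * Z) (X * Y) # map G [0..<n]"
  have len: "length gs = Suc n" by (simp add: gs_def)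
  have combination: "(\<Sum>i<length gs. c i *s gs ! i) =
      syzygy (\<Sum>i<n. c (Suc i) * P i) (c 0 * (Y * Z) + (\<Sum>i<n. c (Suc i) * B1 i))
        (c 0 * (X * Z) + (\<Sum>i<n. c (Suc i) * B2 i)) (c 0 * (X * Y) + (\<Sum>i<n. c (Suc i) * B3 i))"
    (is "_ = syzygy (?p c) (?b1 c) (?b2 c) (?b3 c)") for c
  proof -
    have "(\<Sum>i<length gs. c i *s gs ! i) =
        c 0 *s syzygy 0 (Y * Z) (X * Z) (X * Y) + (\<Sum>i<n. c (Suc i) *s G i)"
      unfolding len sum.lessThan_Suc_shift by (simp add: gs_def)
    also have "\<dots> = syzygy (?p c) (?b1 c) (?b2 c) (?b3 c)"
      unfolding G_def syzygy_sum unfolding syzygy_scale[symmetric] syzygy_add[symmetric] by simp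
    finally show ?thesis .
  qed
  have Kc: "compatible (?p c) (?b1 c) (?b2 c) (?b3 c)" for c
    using compatible_add[OF compatible_scale[OF compatible_line_product, of "c 0"]
        compatible_sum[of "{..<n}" P B1 B2 B3 "\<lambda>i. c (Suc i)"]] K by simp
  show ?thesis
  proof (rule has_min_gensI[of _ gs])
    have 0: "homogeneous_triple 3 (syzygy 0 (Y * Z) (X * Z) (X * Y))"
      using homogeneous_syzygy[of 1 0 "Y * Z" "X * Z" "X * Y"]
        homogeneous_mult[OF hom1(5,6)] homogeneous_mult[OF hom1(4,6)] homogeneous_mult[OF hom1(4,5)]
      by (simp add: numeral_2_eq_2 numeral_3_eq_3)
    have "list_all2 homogeneous_triple (map (\<lambda>i. E i + 2) [0..<n]) (map G [0..<n])"
      unfolding list_all2_map1 list_all2_map2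
      by (rule list_all2_same[THEN iffD2]) (auto simp: G_def simp del: add_2_eq_Suc' intro!: homogeneous_syzygy deg deg(1)[THEN conjunct2])
    with 0 show "list_all2 homogeneous_triple (3 # map (\<lambda>i. E i + 2) [0..<n]) gs"
      by (simp add: gs_def)
  next
    fix g show "g \<in> AR f \<longleftrightarrow> (\<exists>c. g = (\<Sum>i<length gs. c i *s gs ! i))"
      unfolding combination
    proof
      assume "\<exists>c. g = syzygy (?p c) (?b1 c) (?b2 c) (?b3 c)"
      then show "g \<in> AR f" using syzygy_in_AR[OF Kc] by blast
    next
      assume "g \<in> AR f"
      then obtain p b1 b2 b3 where g: "compatible p b1 b2 b3" "g = syzygy p b1 b2 b3"
        using AR_is_syzygy by blast
      obtain r where r: "p = (\<Sum>i<n. r i * P i)" using gen[OF g(1)] by blast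
      have "compatible (p + (\<Sum>i<n. (- r i) * P i)) (b1 + (\<Sum>i<n. (- r i) * B1 i))
          (b2 + (\<Sum>i<n. (- r i) * B2 i)) (b3 + (\<Sum>i<n. (- r i) * B3 i))"
        using compatible_add[OF g(1) compatible_sum[of "{..<n}" P B1 B2 B3 "\<lambda>i. - r i"]] K by simp
      then have "compatible 0 (b1 - (\<Sum>i<n. r i * B1 i)) (b2 - (\<Sum>i<n. r i * B2 i)) (b3 - (\<Sum>i<n. r i * B3 i))"
        by (simp add: r sum_negf)
      then obtain q where q: "b1 - (\<Sum>i<n. r i * B1 i) = q * (Y * Z)"
        "b2 - (\<Sum>i<n. r i * B2 i) = q * (X * Z)" "b3 - (\<Sum>i<n. r i * B3 i) = q * (X * Y)"
        by (rule compatible_0)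
      define c where "c i = (case i of 0 \<Rightarrow> q | Suc j \<Rightarrow> r j)" for i
      have "b1 = ?b1 c" "b2 = ?b2 c" "b3 = ?b3 c" "p = ?p c"
        using r by (simp_all add: c_def diff_eq_eq flip: q)
      then show "\<exists>c. g = syzygy (?p c) (?b1 c) (?b2 c) (?b3 c)" using g(2) by blast
    qed
  next
    fix c assume "(\<Sum>i<length gs. c i *s gs ! i) = 0"
    then have z: "?p c = 0" "?b1 c = 0" using syzygy_eq_0_imp[OF Kc] unfolding combination by blast+
    then have c: "const_term (c (Suc i)) = 0" if "i < n" for i using min[of "\<lambda>i. c (Suc i)"] that by blast
    have t: "hom_part 2 (c (Suc i) * B1 i) = 0" if "i < n" for i
    proof (cases "E i = 1")
      case True
      then have "homogeneous 2 (B1 i)" using deg(2)[OF that] by (simp add: numeral_2_eq_2)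
      from hom_part_mult[OF this, of 0 "c (Suc i)"] show ?thesis
        by (simp add: hom_part_0 c[OF that] mult.commute)
    next
      case False
      then have "2 < Suc (E i)" using deg(1)[OF that] by simp
      from hom_part_mult_less[OF deg(2)[OF that] this, of "c (Suc i)"] show ?thesis
        by (simp add: mult.commute)
    qed
    have hs: "hom_part 2 (\<Sum>i<m. h i) = (\<Sum>i<m. hom_part 2 (h i))" for h :: "nat \<Rightarrow> poly3" and m
      by (induction m) (simp_all add: hom_part_add hom_part_homogeneous)
    have YZ: "homogeneous 2 (Y * Z)" using homogeneous_mult[OF hom1(5,6)] by (simp add: numeral_2_eq_2)
    have "0 = hom_part 2 (?b1 c)" using z(2) by (simp add: hom_part_homogeneous)
    also have "\<dots> = hom_part 2 (c 0 * (Y * Z)) + (\<Sum>i<n. hom_part 2 (c (Suc i) * B1 i))"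
      by (simp only: hom_part_add hs)
    also have "\<dots> = hom_part 2 (Y * Z * c 0)" by (simp add: t mult.commute[of "c 0"])
    also have "\<dots> = Y * Z * const3 (const_term (c 0))"
      using hom_part_mult[OF YZ, of 0 "c 0"] by (simp add: hom_part_0)
    finally have "const_term (c 0) = 0" using lines_neq_0 by simp
    with c show "\<forall>i<length gs. const_term (c i) = 0" by (auto simp: len less_Suc_eq_0_disj)
  qed
qed

section \<open>Which double points impose a condition\<close>

text \<open>
  Each relation, or their difference, is read modulo the two lines that it involves.
\<close>

lemma compatible_imp_in_ideals:
  assumes "compatible p b1 b2 b3"
  shows "p * d \<in> ideal2 X Y" "p * d' \<in> ideal2 X Z" "p * (d' - d) \<in> ideal2 Y Z"
proof -
  have K: "Y * b2 = X * b1 + d * p" "Z * b3 = X * b1 + d' * p"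
    using assms by (simp_all add: compatible_def)
  show "p * d \<in> ideal2 X Y"
    by (rule ideal2I[of _ _ "- b1" _ b2]) (use K(1) in \<open>simp add: algebra_simps\<close>)
  show "p * d' \<in> ideal2 X Z"
    by (rule ideal2I[of _ _ "- b1" _ b3]) (use K(2) in \<open>simp add: algebra_simps\<close>)
  show "p * (d' - d) \<in> ideal2 Y Z"
    by (rule ideal2I[of _ _ "- b2" _ b3]) (use K in \<open>simp add: algebra_simps\<close>)
qed

lemma prime_XY: "p * q \<in> ideal2 X Y \<Longrightarrow> p \<in> ideal2 X Y \<or> q \<in> ideal2 X Y"
  unfolding X_def Y_def by (rule point_ideal_prime[OF XY_distinct])

lemma prime_XZ: "p * q \<in> ideal2 X Z \<Longrightarrow> p \<in> ideal2 X Z \<or> q \<in> ideal2 X Z"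
  unfolding X_def Z_def by (rule point_ideal_prime[OF XZ_distinct])

lemma prime_YZ: "p * q \<in> ideal2 Y Z \<Longrightarrow> p \<in> ideal2 Y Z \<or> q \<in> ideal2 Y Z"
  unfolding Y_def Z_def by (rule point_ideal_prime[OF YZ_distinct])

text \<open>
  Writing \<open>p = X u + Z v\<close>, the product \<open>Z v\<close> lies in the prime ideal of \<open>X \<inter> Y\<close>, and \<open>Z\<close> does not pass
  through this point.
\<close>

lemma in_ideal_XY_XZ:
  assumes "p \<in> ideal2 X Y" "p \<in> ideal2 X Z" "Z \<notin> ideal2 X Y"
  shows "\<exists>u v. p = X * u + Y * Z * v"
proof -
  obtain u v where p: "p = X * u + Z * v" using assms(2) by (rule ideal2E)
  have "Z * v = p - u * X" by (simp add: p mult.commute)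
  also have "\<dots> \<in> ideal2 X Y" by (intro ideal2_diff ideal2_mult assms ideal2_gens)
  finally have "v \<in> ideal2 X Y" using prime_XY assms(3) by blast
  then obtain u' v' where "v = X * u' + Y * v'" by (rule ideal2E)
  then have "p = X * (u + Z * u') + Y * Z * v'" by (simp add: p algebra_simps)
  then show ?thesis by blast
qed

lemmas hom_intros = homogeneous_prods homogeneous_add homogeneous_diff homogeneous_uminus
  hom1[unfolded One_nat_def] hom2 homogeneous_0

text \<open>
  If \<open>p\<close> is the product of two of the lines, the cofactor on the third line can be chosen to be 0; the
  other two cofactors are then obtained by cancelling a line.
\<close>

lemma compatible_YZ: "compatible (Y * Z) 0 (d * Z) (d' * Y)"
  and compatible_XZ: "compatible (X * Z) (- d * Z) 0 ((d' - d) * X)"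
  and compatible_XY: "compatible (X * Y) (- d' * Y) ((d - d') * X) 0"
  by (simp_all add: compatible_def algebra_simps)

text \<open>
  A linear generator of \<open>I\<close> lifts as soon as the conic of the opposite point lies in the ideal of that
  point: for \<open>p = X\<close> the factor \<open>X\<close> cancels, and the remaining conditions \<open>b1 = - d\<close> modulo \<open>Y\<close> and
  \<open>b1 = - d'\<close> modulo \<open>Z\<close> only have to agree at \<open>Y \<inter> Z\<close>.
\<close>

lemma compatible_X:
  "d' - d = Y * v + Z * z \<Longrightarrow> compatible X (- d - Y * v) (- X * v) (X * z)"
  by (simp add: compatible_def algebra_simps flip: eq_diff_eq)

lemma compatible_Y:
  "d' = X * u + Z * z \<Longrightarrow> compatible Y (- Y * u) (d - X * u) (Y * z)"
  by (simp add: compatible_def algebra_simps)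

text \<open>
  Here \<open>I\<close> is the intersection of the ideals of the three points, which is \<open>(Y Z, X Z, X Y)\<close>.
\<close>

lemma exponents_three_conditions:
  assumes "Z \<notin> ideal2 X Y" "X \<notin> ideal2 Y Z"
    and "d \<notin> ideal2 X Y" "d' \<notin> ideal2 X Z" "d' - d \<notin> ideal2 Y Z"
  shows "has_min_gens (AR f) [3, 4, 4, 4]"
proof -
  let ?E = "\<lambda>i::nat. 2::nat"
  have "has_min_gens (AR f) (3 # map (\<lambda>i. ?E i + 2) [0..<3])"
  proof (rule min_gens_from_ideal[where
      P = "\<lambda>i. [Y * Z, X * Z, X * Y] ! i" and ?B1.0 = "\<lambda>i. [0, - d * Z, - d' * Y] ! i" and
      ?B2.0 = "\<lambda>i. [d * Z, 0, (d - d') * X] ! i" and ?B3.0 = "\<lambda>i. [d' * Y, (d' - d) * X, 0] ! i"],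
      goal_cases)
    case (1 i) then show ?case
      using compatible_YZ compatible_XZ compatible_XY by (auto simp: less_2_3 numeral_2_eq_2)
  next
    case (2 i) then show ?case unfolding less_2_3 by (elim disjE) (simp_all add: hom_intros)
  next
    case (3 i) then show ?case unfolding less_2_3
      by (elim disjE) (simp_all add: hom_intros flip: numeral_2_eq_2 numeral_3_eq_3)
  next
    case (4 i) then show ?case unfolding less_2_3
      by (elim disjE) (simp_all add: hom_intros flip: numeral_2_eq_2 numeral_3_eq_3)
  next
    case (5 i) then show ?case unfolding less_2_3
      by (elim disjE) (simp_all add: hom_intros flip: numeral_2_eq_2 numeral_3_eq_3)
  next
    case (6 p b1 b2 b3)
    from compatible_imp_in_ideals[OF 6] prime_XY prime_XZ prime_YZ assms
    have p: "p \<in> ideal2 X Y" "p \<in> ideal2 X Z" "p \<in> ideal2 Y Z" by blast+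
    obtain u v where uv: "p = X * u + Y * Z * v" using in_ideal_XY_XZ[OF p(1,2) assms(1)] by blast
    have "X * u = p - (Z * v) * Y" by (simp add: uv algebra_simps)
    also have "\<dots> \<in> ideal2 Y Z" by (intro ideal2_diff ideal2_mult p ideal2_gens)
    finally have "u \<in> ideal2 Y Z" using prime_YZ assms(2) by blast
    then obtain u1 u2 where "u = Y * u1 + Z * u2" by (rule ideal2E)
    then have "p = v * (Y * Z) + u2 * (X * Z) + u1 * (X * Y)" by (simp add: uv algebra_simps)
    then show ?case
      by (intro exI[of _ "\<lambda>i. [v, u2, u1] ! i"]) (simp add: sum_less_2_3)
  next
    case (7 r)
    then have z: "r 0 * (Y * Z) + r 1 * (X * Z) + r 2 * (X * Y) = 0" by (simp add: sum_less_2_3)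
    have "r 0 * (Y * Z) = X * (- r 1 * Z - r 2 * Y)" "r 1 * (X * Z) = Y * (- r 0 * Z - r 2 * X)"
      "r 2 * (X * Y) = Z * (- r 0 * Y - r 1 * X)"
      using z by (simp_all add: algebra_simps eq_neg_iff_add_eq_0)
    then have "X dvd r 0 * (Y * Z)" "Y dvd r 1 * (X * Z)" "Z dvd r 2 * (X * Y)" by (metis dvd_triv_left)+
    then have "X dvd r 0" "Y dvd r 1" "Z dvd r 2" by (simp_all add: primes not_dvd)
    then show ?case using const_term_eq_0_if_dvd hom1 by (auto simp: less_2_3)
  qed
  then show ?thesis by (simp add: eval_nat_numeral upt_rec)
qed

text \<open>
  Here \<open>I\<close> is the ideal \<open>(X, Y Z)\<close> of the points \<open>X \<inter> Y\<close> and \<open>X \<inter> Z\<close>.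
\<close>

lemma exponents_two_conditions:
  assumes "Z \<notin> ideal2 X Y" "d \<notin> ideal2 X Y" "d' \<notin> ideal2 X Z" "d' - d \<in> ideal2 Y Z"
  shows "has_min_gens (AR f) [3, 3, 4]"
proof -
  obtain v z where vz: "d' - d = Y * v + Z * z" "homogeneous (Suc 0) v" "homogeneous (Suc 0) z"
    using assms(4) by (rule homogeneous_ideal2) (intro hom_intros hom1)+
  let ?E = "\<lambda>i::nat. i + 1"
  have "has_min_gens (AR f) (3 # map (\<lambda>i. ?E i + 2) [0..<2])"
  proof (rule min_gens_from_ideal[where
      P = "\<lambda>i. [X, Y * Z] ! i" and ?B1.0 = "\<lambda>i. [- d - Y * v, 0] ! i" and
      ?B2.0 = "\<lambda>i. [- X * v, d * Z] ! i" and ?B3.0 = "\<lambda>i. [X * z, d' * Y] ! i"],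
      goal_cases)
    case (1 i) then show ?case
      using compatible_YZ compatible_X[OF vz(1)] by (auto simp: less_2_3)
  next
    case (2 i) then show ?case unfolding less_2_3 by (elim disjE) (simp_all add: hom_intros vz(2,3) flip: numeral_2_eq_2)
  next
    case (3 i) then show ?case unfolding less_2_3
      by (elim disjE) (simp_all add: hom_intros vz(2,3) flip: numeral_2_eq_2 numeral_3_eq_3)
  next
    case (4 i) then show ?case unfolding less_2_3
      by (elim disjE) (simp_all add: hom_intros vz(2,3) flip: numeral_2_eq_2 numeral_3_eq_3)
  next
    case (5 i) then show ?case unfolding less_2_3
      by (elim disjE) (simp_all add: hom_intros vz(2,3) flip: numeral_2_eq_2 numeral_3_eq_3)
  next
    case (6 p b1 b2 b3)
    from compatible_imp_in_ideals[OF 6] prime_XY prime_XZ assms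
    have p: "p \<in> ideal2 X Y" "p \<in> ideal2 X Z" by blast+
    obtain r0 r1 where "p = X * r0 + Y * Z * r1" using in_ideal_XY_XZ[OF p assms(1)] by blast
    then show ?case
      by (intro exI[of _ "\<lambda>i. [r0, r1] ! i"]) (simp add: sum_less_2_3 algebra_simps)
  next
    case (7 r)
    then have "r 0 * X + r 1 * (Y * Z) = 0" by (simp add: sum_less_2_3)
    from two_term_relation[OF this hom1(4) hom1(5)] show ?case
      by (auto simp: less_2_3 primes not_dvd)
  qed
  then show ?thesis by (simp add: eval_nat_numeral upt_rec)
qed

text \<open>
  Here \<open>I\<close> is the ideal \<open>(X, Y)\<close> of a single point.
\<close>

lemma exponents_one_condition:
  assumes "d \<notin> ideal2 X Y" "d' \<in> ideal2 X Z" "d' - d \<in> ideal2 Y Z"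
  shows "has_min_gens (AR f) [3, 3, 3]"
proof -
  obtain v z where vz: "d' - d = Y * v + Z * z" "homogeneous (Suc 0) v" "homogeneous (Suc 0) z"
    using assms(3) by (rule homogeneous_ideal2) (intro hom_intros hom1)+
  obtain u z' where uz: "d' = X * u + Z * z'" "homogeneous (Suc 0) u" "homogeneous (Suc 0) z'"
    using assms(2) by (rule homogeneous_ideal2) (intro hom_intros hom1)+
  let ?E = "\<lambda>i::nat. 1::nat"
  have "has_min_gens (AR f) (3 # map (\<lambda>i. ?E i + 2) [0..<2])"
  proof (rule min_gens_from_ideal[where
      P = "\<lambda>i. [X, Y] ! i" and ?B1.0 = "\<lambda>i. [- d - Y * v, - Y * u] ! i" and
      ?B2.0 = "\<lambda>i. [- X * v, d - X * u] ! i" and ?B3.0 = "\<lambda>i. [X * z, Y * z'] ! i"],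
      goal_cases)
    case (1 i) then show ?case
      using compatible_Y[OF uz(1)] compatible_X[OF vz(1)] by (auto simp: less_2_3)
  next
    case (2 i) then show ?case unfolding less_2_3 by (elim disjE) (simp_all add: hom_intros)
  next
    case (3 i) then show ?case unfolding less_2_3
      by (elim disjE) (simp_all add: hom_intros vz(2,3) uz(2,3) flip: numeral_2_eq_2 numeral_3_eq_3)
  next
    case (4 i) then show ?case unfolding less_2_3
      by (elim disjE) (simp_all add: hom_intros vz(2,3) uz(2,3) flip: numeral_2_eq_2 numeral_3_eq_3)
  next
    case (5 i) then show ?case unfolding less_2_3
      by (elim disjE) (simp_all add: hom_intros vz(2,3) uz(2,3) flip: numeral_2_eq_2 numeral_3_eq_3)
  next
    case (6 p b1 b2 b3)
    from compatible_imp_in_ideals[OF 6] prime_XY assms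
    have p: "p \<in> ideal2 X Y" by blast
    then obtain r0 r1 where "p = X * r0 + Y * r1" by (rule ideal2E)
    then show ?case
      by (intro exI[of _ "\<lambda>i. [r0, r1] ! i"]) (simp add: sum_less_2_3 algebra_simps)
  next
    case (7 r)
    then have "r 0 * X + r 1 * Y = 0" by (simp add: sum_less_2_3)
    from two_term_relation[OF this hom1(4) hom1(5)] show ?case
      by (auto simp: less_2_3 primes not_dvd)
  qed
  then show ?thesis by (simp add: eval_nat_numeral upt_rec)
qed

text \<open>
  A Chinese remainder argument: a solution with \<open>p = 1\<close> prescribes \<open>X b1\<close> modulo each of \<open>X\<close>, \<open>Y\<close>, \<open>Z\<close>.
  The prescriptions agree at the three intersection points; as \<open>X\<close> does not pass through \<open>Y \<inter> Z\<close>, the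
  solutions along \<open>Y\<close> and along \<open>Z\<close> can be glued after division by \<open>X\<close>.
\<close>

lemma compatible_1:
  assumes "X \<notin> ideal2 Y Z" "d \<in> ideal2 X Y" "d' \<in> ideal2 X Z" "d' - d \<in> ideal2 Y Z"
  obtains b1 b2 b3 where "compatible 1 b1 b2 b3"
    "homogeneous 1 b1" "homogeneous 1 b2" "homogeneous 1 b3"
proof -
  obtain u v where d: "d = X * u + Y * v" using assms(2) by (rule ideal2E)
  obtain u' z where d': "d' = X * u' + Z * z" using assms(3) by (rule ideal2E)
  have "X * (u' - u) = (d' - d) + v * Y - z * Z" by (simp add: d d' algebra_simps)
  also have "\<dots> \<in> ideal2 Y Z" by (intro ideal2_diff ideal2_add ideal2_mult assms ideal2_gens)
  finally have "u' - u \<in> ideal2 Y Z" using prime_YZ assms(1) by blast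
  then obtain g h where gh: "u' - u = Y * g + Z * h" by (rule ideal2E)
  have "u' = u + Y * g + Z * h" using gh by (simp add: algebra_simps)
  then have "compatible 1 (- u - Y * g) (v - X * g) (X * h + z)"
    by (simp add: compatible_def d d' algebra_simps)
  from compatible_hom_part[OF this, of 0] that show ?thesis
    using homogeneous_const[of 1] by simp
qed

text \<open>
  With \<open>p = 1\<close> in the ideal, its lift and the syzygy of degree 3 form a basis.
\<close>

lemma free_if_no_condition:
  assumes "X \<notin> ideal2 Y Z" "d \<in> ideal2 X Y" "d' \<in> ideal2 X Z" "d' - d \<in> ideal2 Y Z"
  shows "has_min_gens (AR f) [2, 3] \<and> (\<exists>B. syz.independent B \<and> syz.span B = AR f)"
proof -
  obtain b1 b2 b3 where K: "compatible 1 b1 b2 b3" and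
    b: "homogeneous 1 b1" "homogeneous 1 b2" "homogeneous 1 b3"
    using compatible_1[OF assms] by metis
  define G0 G1 where "G0 = syzygy 1 b1 b2 b3" and "G1 = syzygy 0 (Y * Z) (X * Z) (X * Y)"
  have comb: "q *s G0 + r *s G1 = syzygy q (q * b1 + r * (Y * Z)) (q * b2 + r * (X * Z)) (q * b3 + r * (X * Y))"
    for q r
    unfolding G0_def G1_def syzygy_scale[symmetric] syzygy_add[symmetric] by simp
  have Kc: "compatible q (q * b1 + r * (Y * Z)) (q * b2 + r * (X * Z)) (q * b3 + r * (X * Y))" for q r
    using compatible_add[OF compatible_scale[OF K, of q] compatible_scale[OF compatible_line_product, of r]]
    by simp
  have AR: "g \<in> AR f \<longleftrightarrow> (\<exists>q r. g = q *s G0 + r *s G1)" for g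
  proof
    assume "\<exists>q r. g = q *s G0 + r *s G1"
    then show "g \<in> AR f" using syzygy_in_AR[OF Kc] unfolding comb by blast
  next
    assume "g \<in> AR f"
    then obtain p c1 c2 c3 where g: "compatible p c1 c2 c3" "g = syzygy p c1 c2 c3"
      using AR_is_syzygy by blast
    have "compatible 0 (c1 - p * b1) (c2 - p * b2) (c3 - p * b3)"
      using compatible_add[OF g(1) compatible_scale[OF K, of "- p"]] by simp
    then obtain r where r: "c1 - p * b1 = r * (Y * Z)" "c2 - p * b2 = r * (X * Z)" "c3 - p * b3 = r * (X * Y)"
      by (rule compatible_0)
    have "g = p *s G0 + r *s G1" unfolding comb g(2) by (simp flip: r)
    then show "\<exists>q r. g = q *s G0 + r *s G1" by blast
  qed
  have indep: "q = 0 \<and> r = 0" if "q *s G0 + r *s G1 = 0" for q r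
  proof -
    have "q = 0 \<and> q * b1 + r * (Y * Z) = 0"
      using syzygy_eq_0_imp[OF Kc] that unfolding comb by blast
    then show ?thesis using lines_neq_0 by auto
  qed
  have hom: "homogeneous_triple 2 G0" "homogeneous_triple 3 G1"
  proof -
    show "homogeneous_triple 2 G0"
      using homogeneous_syzygy[of 0 1 b1 b2 b3] homogeneous_const[of 1] b
      by (simp add: G0_def numeral_2_eq_2)
    show "homogeneous_triple 3 G1"
      using homogeneous_syzygy[of 1 0 "Y * Z" "X * Z" "X * Y"]
        homogeneous_mult[OF hom1(5,6)] homogeneous_mult[OF hom1(4,6)] homogeneous_mult[OF hom1(4,5)]
      by (simp add: G1_def numeral_2_eq_2 numeral_3_eq_3)
  qed
  have "has_min_gens (AR f) [2, 3]"
  proof (rule has_min_gensI[of _ "[G0, G1]"])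
    show "list_all2 homogeneous_triple [2, 3] [G0, G1]" using hom by simp
    show "g \<in> AR f \<longleftrightarrow> (\<exists>c. g = (\<Sum>i<length [G0, G1]. c i *s [G0, G1] ! i))" for g
    proof -
      have "(\<exists>q r. g = q *s G0 + r *s G1) \<longleftrightarrow> (\<exists>c :: nat \<Rightarrow> poly3. g = c 0 *s G0 + c 1 *s G1)"
        (is "?L \<longleftrightarrow> ?R")
      proof
        assume ?L
        then obtain q r where "g = q *s G0 + r *s G1" by blast
        then show ?R by (intro exI[of _ "\<lambda>i. if i = 0 then q else r"]) simp
      qed blast
      then show ?thesis by (simp add: AR)
    qed
    show "\<forall>i<length [G0, G1]. const_term (c i) = 0"
      if "(\<Sum>i<length [G0, G1]. c i *s [G0, G1] ! i) = 0" for c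
      using indep[of "c 0" "c 1"] that by (auto simp: less_Suc_eq)
  qed
  moreover have "G0 \<noteq> G1" using indep[of 1 "-1"] by auto
  have "syz.independent {G0, G1}"
    unfolding syz.dependent_finite[OF finite.insertI[OF finite.insertI[OF finite.emptyI]]]
    using \<open>G0 \<noteq> G1\<close> indep by auto
  moreover have "syz.span {G0, G1} = AR f"
    unfolding set_eq_iff AR syz.span_breakdown_eq syz.span_singleton
    by (auto simp: image_iff algebra_simps diff_eq_eq)
  ultimately show ?thesis by blast
qed

text \<open>
  The three lines are \<open>X\<close>, \<open>X + m\<close> and \<open>X + k m\<close>, where \<open>m\<close> is the line joining the two triple points, and
  \<open>d' = k d\<close>.  Eliminating \<open>b2\<close> and \<open>b3\<close> shows that \<open>Y Z\<close> divides \<open>m b1 - d p\<close>.  Modulo \<open>m\<close> all of \<open>X\<close>,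
  \<open>Y\<close>, \<open>Z\<close> coincide and \<open>d\<close> is prime to \<open>X\<close>, so that \<open>X\<^sup>2\<close> divides \<open>p\<close>: this gives \<open>I = (m, Y Z)\<close>.
\<close>

lemma exponents_concurrent:
  assumes "s' = k * s" "t' = k * t" "d \<notin> ideal2 X Y"
  shows "has_min_gens (AR f) [3, 3, 4]"
proof -
  define cm where "cm = s *s a + t *s b"
  define m where "m = lin cm"
  have m_eq: "m = const3 s * x + const3 t * y" by (simp add: m_def cm_def line_defs lin_hom)
  have k: "const3 s' = const3 k * const3 s" "const3 t' = const3 k * const3 t"
    unfolding assms(1,2) by (simp_all add: const3_hom)
  have Y: "Y = X + m" and Z: "Z = X + const3 k * m" and d'_eq: "d' = const3 k * d"
    unfolding Y_eq Z_eq m_eq d_def d'_def k by (simp_all add: algebra_simps)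
  have hm: "homogeneous 1 m" unfolding m_def by (rule homogeneous_lin)
  have Xm: "cross c cm \<noteq> 0" using XY_distinct by (simp add: cross_add cm_def)
  then have mX: "cross cm c \<noteq> 0" using cross_commute[of cm c] by auto
  have cm0: "cm \<noteq> 0" using Xm by (auto simp: vec3_simps)
  have m0: "m \<noteq> 0" using cm0 by (simp add: m_def)
  have I: "ideal2 X Y = ideal2 m X"
  proof (safe elim!: ideal2E)
    fix u v show "X * u + Y * v \<in> ideal2 m X" by (rule ideal2I[of _ _ v _ "u + v"]) (simp add: Y algebra_simps)
    show "m * u + X * v \<in> ideal2 X Y" by (rule ideal2I[of _ _ "v - u" _ u]) (simp add: Y algebra_simps)
  qed
  have prime_m: "m dvd p * q \<longleftrightarrow> m dvd p \<or> m dvd q" for p q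
    unfolding m_def by (meson lin_prime cm0 dvd_mult dvd_mult2)
  have m_X: "\<not> m dvd X" "\<not> X dvd m"
    unfolding m_def X_def lin_dvd_lin_iff[OF cm0] lin_dvd_lin_iff[OF neq0(4)] by (rule Xm mX)+
  have m_YZ: "\<not> m dvd Y" "\<not> m dvd Z"
    using m_X dvd_add_left_iff[of m m X] dvd_add_left_iff[of m "const3 k * m" X] by (simp_all add: Y Z)
  have Y_m: "\<not> Y dvd m"
  proof
    assume "Y dvd m"
    then have "Y dvd X" unfolding Y by (metis dvd_add_left_iff dvd_refl)
    then show False using not_dvd by blast
  qed
  let ?E = "\<lambda>i::nat. i + 1"
  have "has_min_gens (AR f) (3 # map (\<lambda>i. ?E i + 2) [0..<2])"
  proof (rule min_gens_from_ideal[where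
      P = "\<lambda>i. [m, Y * Z] ! i" and ?B1.0 = "\<lambda>i. [d, 0] ! i" and
      ?B2.0 = "\<lambda>i. [d, d * Z] ! i" and ?B3.0 = "\<lambda>i. [d, d' * Y] ! i"],
      goal_cases)
    have "compatible m d d d" by (simp add: compatible_def Y Z d'_eq algebra_simps)
    then show "compatible ([m, Y * Z] ! i) ([d, 0] ! i) ([d, d * Z] ! i) ([d, d' * Y] ! i)" if "i < 2" for i
      using compatible_YZ that by (auto simp: less_2_3)
  next
    case (2 i) then show ?case unfolding less_2_3 by (elim disjE) (simp_all add: hom_intros hm[unfolded One_nat_def] flip: numeral_2_eq_2)
  next
    case (3 i) then show ?case unfolding less_2_3
      by (elim disjE) (simp_all add: hom_intros flip: numeral_2_eq_2 numeral_3_eq_3)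
  next
    case (4 i) then show ?case unfolding less_2_3
      by (elim disjE) (simp_all add: hom_intros flip: numeral_2_eq_2 numeral_3_eq_3)
  next
    case (5 i) then show ?case unfolding less_2_3
      by (elim disjE) (simp_all add: hom_intros flip: numeral_2_eq_2 numeral_3_eq_3)
  next
    case (6 p b1 b2 b3)
    then have K: "Y * b2 = X * b1 + d * p" "Z * b3 = X * b1 + const3 k * d * p"
      by (simp_all add: compatible_def d'_eq)
    have "Y * (b1 - b2) = m * b1 - d * p"
      using K(1) by (simp add: Y algebra_simps)
    moreover have "Z * (b1 - b3) = const3 k * (m * b1 - d * p)"
      using K(2) by (simp add: Z algebra_simps)
    ultimately have "Y dvd m * b1 - d * p" "Z dvd const3 k * (m * b1 - d * p)"
      by (metis dvd_triv_left)+
    moreover have "k \<noteq> 0" using Z X_def not_dvd by auto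
    then have "const3 (1 / k) * (const3 k * q) = q" for q by (simp flip: const3_hom mult.assoc)
    ultimately have "Y dvd m * b1 - d * p" "Z dvd m * b1 - d * p" by (metis dvd_mult)+
    then obtain q where q: "m * b1 - d * p = Y * q" by (auto simp: dvd_def)
    with \<open>Z dvd m * b1 - d * p\<close> have "Z dvd q" by (simp add: primes not_dvd)
    then obtain r where "q = Z * r" by (auto simp: dvd_def)
    with q have dp: "d * p = m * b1 - Y * Z * r" by (simp add: algebra_simps)
    \<comment> \<open>\<open>Y Z\<close> is \<open>X\<^sup>2\<close> modulo \<open>m\<close>; the difference is absorbed into \<open>h\<close>\<close>
    define h where "h = b1 - (const3 k * m + X + const3 k * X) * r"
    have dp: "d * p = m * h - X * (X * r)"
      unfolding dp Y Z h_def by (simp add: algebra_simps)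
    have "d * p \<in> ideal2 m X" by (rule ideal2I[of _ _ h _ "- (X * r)"]) (simp add: dp)
    then have "p \<in> ideal2 m X" using prime_XY assms(3) I by blast
    then obtain u p1 where p1: "p = m * u + X * p1" by (rule ideal2E)
    have "X * (d * p1 + X * r) = m * (h - d * u)"
      using dp unfolding p1 by (simp add: algebra_simps)
    then have "m dvd X * (d * p1 + X * r)" by (metis dvd_triv_left)
    then have "m dvd d * p1 + X * r" using prime_m m_X by blast
    then obtain h' where "d * p1 + X * r = m * h'" by (auto simp: dvd_def)
    then have "d * p1 = m * h' + X * (- r)" by (simp add: algebra_simps)
    then have "p1 \<in> ideal2 m X" using ideal2I prime_XY assms(3) I by blast
    then obtain u1 r1 where r1: "p1 = m * u1 + X * r1" by (rule ideal2E)
    have "p = (u + X * u1 - (const3 k * m + X + const3 k * X) * r1) * m + r1 * (Y * Z)"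
      unfolding p1 r1 Y Z by (simp add: algebra_simps)
    then show ?case
      by (intro exI[of _ "\<lambda>i. [u + X * u1 - (const3 k * m + X + const3 k * X) * r1, r1] ! i"])
         (simp add: sum_less_2_3)
  next
    case (7 r)
    then have "r 0 * m + r 1 * (Y * Z) = 0" by (simp add: sum_less_2_3)
    from two_term_relation[OF this hm hom1(5)] show ?case
      by (auto simp: less_2_3 primes not_dvd prime_m m_YZ Y_m)
  qed
  then show ?thesis by (simp add: eval_nat_numeral upt_rec)
qed

end

text \<open>
  The form \<open>b\<close> is missing from the conic, but it enters through \<open>q - p = \<sigma> a + \<tau> b\<close>, which vanishes at
  the point: if \<open>b\<close> vanishes there, so does \<open>\<sigma> a\<close>; and if \<open>\<sigma> = 0\<close>, then \<open>\<tau> \<noteq> 0\<close> and \<open>b\<close> vanishes.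
\<close>

lemma conic_in_point_ideal_iff:
  assumes "cross p q \<noteq> 0" and q: "q = p + (\<sigma> *s a + \<tau> *s b)"
  shows "const3 \<sigma> * lin a * lin (a + b) \<in> ideal2 (lin p) (lin q) \<longleftrightarrow>
    dot a (cross p q) = 0 \<or> dot b (cross p q) = 0 \<or> dot (a + b) (cross p q) = 0"
proof -
  let ?n = "cross p q" and ?I = "ideal2 (lin p) (lin q)"
  have "const3 \<sigma> * lin a * lin (a + b) \<in> ?I \<longleftrightarrow> const3 \<sigma> \<in> ?I \<or> lin a \<in> ?I \<or> lin (a + b) \<in> ?I"
    using point_ideal_prime[OF assms(1)] ideal2_mult by (metis mult.commute)
  also have "const3 \<sigma> \<in> ?I \<longleftrightarrow> \<sigma> = 0"
    using const_notin_point_ideal ideal2_gens(3) by (metis const3_simps(1))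
  finally have 1: "const3 \<sigma> * lin a * lin (a + b) \<in> ?I \<longleftrightarrow> \<sigma> = 0 \<or> dot a ?n = 0 \<or> dot (a + b) ?n = 0"
    unfolding lin_in_point_ideal_iff[OF assms(1)] .
  have "dot q ?n = dot p ?n + (\<sigma> * dot a ?n + \<tau> * dot b ?n)"
    by (subst q) (simp add: dot_simps)
  then have 2: "\<sigma> * dot a ?n + \<tau> * dot b ?n = 0"
    by (simp add: dot_cross_self)
  have "\<tau> \<noteq> 0" if "\<sigma> = 0"
    using assms(1) that by (auto simp: q)
  with 1 2 show ?thesis by auto
qed

context triple_point_lines
begin

definition on_pencil :: "complex ^ 3 \<Rightarrow> bool" where
  "on_pencil n \<longleftrightarrow> dot a n = 0 \<or> dot b n = 0 \<or> dot (a + b) n = 0"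

lemma conditions_iff:
  "d \<in> ideal2 X Y \<longleftrightarrow> on_pencil (cross c cY)"
  "d' \<in> ideal2 X Z \<longleftrightarrow> on_pencil (cross c cZ)"
  "d' - d \<in> ideal2 Y Z \<longleftrightarrow> on_pencil (cross cY cZ)"
proof -
  show "d \<in> ideal2 X Y \<longleftrightarrow> on_pencil (cross c cY)"
    unfolding d_def line_defs on_pencil_def by (rule conic_in_point_ideal_iff[OF XY_distinct refl])
  show "d' \<in> ideal2 X Z \<longleftrightarrow> on_pencil (cross c cZ)"
    unfolding d'_def line_defs on_pencil_def by (rule conic_in_point_ideal_iff[OF XZ_distinct refl])
  have "d' - d = const3 (s' - s) * lin a * lin (a + b)"
    by (simp add: d_def d'_def line_defs const3_hom algebra_simps)
  moreover have "cZ = cY + ((s' - s) *s a + (t' - t) *s b)"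
    by (simp add: vec_eq_iff algebra_simps)
  ultimately show "d' - d \<in> ideal2 Y Z \<longleftrightarrow> on_pencil (cross cY cZ)"
    using conic_in_point_ideal_iff[OF YZ_distinct] unfolding on_pencil_def Y_def Z_def by metis
qed

lemma concurrent_iff:
  "Z \<in> ideal2 X Y \<longleftrightarrow> dot cZ (cross c cY) = 0" "X \<in> ideal2 Y Z \<longleftrightarrow> dot cZ (cross c cY) = 0"
proof -
  show "Z \<in> ideal2 X Y \<longleftrightarrow> dot cZ (cross c cY) = 0"
    unfolding line_defs by (rule lin_in_point_ideal_iff[OF XY_distinct])
  have "X \<in> ideal2 Y Z \<longleftrightarrow> dot c (cross cY cZ) = 0"
    unfolding line_defs by (rule lin_in_point_ideal_iff[OF YZ_distinct])
  then show "X \<in> ideal2 Y Z \<longleftrightarrow> dot cZ (cross c cY) = 0"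
    by (metis dot_cross_rotate)
qed

lemma concurrent_imp_pencil:
  assumes "dot cZ (cross c cY) = 0" obtains k where "s' = k * s" "t' = k * t"
proof -
  have "dot cZ (cross c cY) = (s * t' - s' * t) * dot c (cross a b)"
    by (simp add: vec3_simps algebra_simps)
  with assms indep have e: "s * t' = s' * t" by simp
  have "s \<noteq> 0 \<or> t \<noteq> 0" using XY_distinct by auto
  then show ?thesis
  proof
    assume "s \<noteq> 0" with e show ?thesis by (intro that[of "s' / s"]) (simp_all add: field_simps)
  next
    assume "t \<noteq> 0" with e show ?thesis by (intro that[of "t' / t"]) (simp_all add: field_simps)
  qed
qed

end

lemma AR_scale: "k \<noteq> 0 \<Longrightarrow> AR (const3 k * f) = AR f"
proof -
  assume k: "k \<noteq> 0"
  have "deriv_along g (const3 k * f) = const3 k * deriv_along g f" for g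
    unfolding deriv_along_mult by (simp add: deriv_along_def pdv_const)
  with k show ?thesis by (auto simp: AR_iff)
qed

definition triple_point_config where
  "triple_point_config a1 a2 a3 a4 a5 a6 \<longleftrightarrow>
     cross a1 a2 \<noteq> 0 \<and> cross a1 a3 \<noteq> 0 \<and> cross a2 a3 \<noteq> 0 \<and>
     cross a4 a5 \<noteq> 0 \<and> cross a4 a6 \<noteq> 0 \<and> cross a5 a6 \<noteq> 0 \<and>
     dot a3 (cross a1 a2) = 0 \<and> dot a4 (cross a1 a2) \<noteq> 0 \<and>
     dot a5 (cross a1 a2) \<noteq> 0 \<and> dot a6 (cross a1 a2) \<noteq> 0"

text \<open>
  The third line is a combination of the first two because it passes through their intersection;
  scaling these two makes it their sum.  The last two lines avoid the triple point, so their
  coordinate along \<open>a4\<close> can be scaled to 1.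
\<close>

lemma normal_form:
  assumes "triple_point_config a1 a2 a3 a4 a5 a6"
  obtains a b du dv dw s t s' t' \<alpha> \<beta> \<gamma> \<delta> where
    "triple_point_lines a b a4 du dv dw s t s' t'"
    "\<alpha> \<noteq> 0" "\<beta> \<noteq> 0" "\<gamma> \<noteq> 0" "\<delta> \<noteq> 0"
    "a = \<alpha> *s a1" "b = \<beta> *s a2" "a3 = a + b"
    "a5 = \<gamma> *s (a4 + (s *s a + t *s b))" "a6 = \<delta> *s (a4 + (s' *s a + t' *s b))"
proof -
  note C = assms[unfolded triple_point_config_def]
  obtain u v where "dual_bases a1 a2 a4 u v ((1 / dot a4 (cross a1 a2)) *s cross a1 a2)"
    using dual_bases_exist C by blast
  from dual_bases_expand[OF this, of a3] C have a3: "a3 = dot a3 u *s a1 + dot a3 v *s a2"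
    by (simp add: dot_simps)
  define \<alpha> \<beta> where "\<alpha> = dot a3 u" "\<beta> = dot a3 v"
  define a b where "a = \<alpha> *s a1" "b = \<beta> *s a2"
  have a3: "a3 = a + b" using a3 by (simp add: \<alpha>_\<beta>_def a_b_def)
  have \<alpha>: "\<alpha> \<noteq> 0" using C by (auto simp: a3 a_b_def cross_scale)
  have \<beta>: "\<beta> \<noteq> 0" using C by (auto simp: a3 a_b_def cross_scale)
  have n: "cross a b = (\<alpha> * \<beta>) *s cross a1 a2" by (simp add: a_b_def cross_scale)
  have D: "dot a4 (cross a b) \<noteq> 0" using \<alpha> \<beta> C by (simp add: n dot_simps)
  then obtain du dv dw where dual: "dual_bases a b a4 du dv dw"
    and dw: "dw = (1 / dot a4 (cross a b)) *s cross a b" using dual_bases_exist by blast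
  have dw0: "dot a5 dw \<noteq> 0" "dot a6 dw \<noteq> 0" using D \<alpha> \<beta> C unfolding dw n by (simp_all add: dot_simps)
  have normal: "l = dot l dw *s (a4 + ((dot l du / dot l dw) *s a + (dot l dv / dot l dw) *s b))"
    if "dot l dw \<noteq> 0" for l
    using that
    by (subst dual_bases_expand[OF dual, of l]) (simp add: vec_eq_iff field_simps)
  define s t s' t' where "s = dot a5 du / dot a5 dw" "t = dot a5 dv / dot a5 dw"
    "s' = dot a6 du / dot a6 dw" "t' = dot a6 dv / dot a6 dw"
  have a5: "a5 = dot a5 dw *s (a4 + (s *s a + t *s b))" and a6: "a6 = dot a6 dw *s (a4 + (s' *s a + t' *s b))"
    using normal[OF dw0(1)] normal[OF dw0(2)] by (simp_all add: s_t_s'_t'_def)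
  have "triple_point_lines a b a4 du dv dw s t s' t'"
  proof
    show "dot a4 (cross a b) \<noteq> 0" by (rule D)
    show "dual_bases a b a4 du dv dw" by (rule dual)
    show "cross a4 (a4 + (s *s a + t *s b)) \<noteq> 0" using C a5 cross_scale by (metis vector_smult_rzero)
    show "cross a4 (a4 + (s' *s a + t' *s b)) \<noteq> 0" using C a6 cross_scale by (metis vector_smult_rzero)
    show "cross (a4 + (s *s a + t *s b)) (a4 + (s' *s a + t' *s b)) \<noteq> 0"
      using C a5 a6 cross_scale by (metis vector_smult_rzero)
  qed
  from that[OF this \<alpha> \<beta> dw0 a_b_def a3 a5 a6] show ?thesis .
qed

text \<open>
  The cases of the normal form, expressed for the unscaled lines: \<open>g p q\<close> says that the intersection of
  \<open>p\<close> and \<open>q\<close> lies on one of the three lines through the triple point.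
\<close>

lemma config_exponents:
  assumes C: "triple_point_config a1 a2 a3 a4 a5 a6"
  defines "F \<equiv> lin a1 * lin a2 * lin a3 * lin a4 * lin a5 * lin a6"
    and "g \<equiv> \<lambda>p q. dot a1 (cross p q) = 0 \<or> dot a2 (cross p q) = 0 \<or> dot a3 (cross p q) = 0"
  shows "dot a6 (cross a4 a5) = 0 \<Longrightarrow> \<not> g a4 a5 \<Longrightarrow> has_min_gens (AR F) [3, 3, 4]"
    and "dot a6 (cross a4 a5) \<noteq> 0 \<Longrightarrow> \<not> g a4 a5 \<Longrightarrow> \<not> g a4 a6 \<Longrightarrow> \<not> g a5 a6 \<Longrightarrow>
      has_min_gens (AR F) [3, 4, 4, 4]"
    and "dot a6 (cross a4 a5) \<noteq> 0 \<Longrightarrow> \<not> g a4 a5 \<Longrightarrow> \<not> g a4 a6 \<Longrightarrow> g a5 a6 \<Longrightarrow>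
      has_min_gens (AR F) [3, 3, 4]"
    and "\<not> g a4 a5 \<Longrightarrow> g a4 a6 \<Longrightarrow> g a5 a6 \<Longrightarrow> has_min_gens (AR F) [3, 3, 3]"
    and "dot a6 (cross a4 a5) \<noteq> 0 \<Longrightarrow> g a4 a5 \<Longrightarrow> g a4 a6 \<Longrightarrow> g a5 a6 \<Longrightarrow>
      has_min_gens (AR F) [2, 3] \<and> (\<exists>B. syz.independent B \<and> syz.span B = AR F)"
proof -
  obtain a b du dv dw s t s' t' \<alpha> \<beta> \<gamma> \<delta> where
    L: "triple_point_lines a b a4 du dv dw s t s' t'"
    and nz: "\<alpha> \<noteq> 0" "\<beta> \<noteq> 0" "\<gamma> \<noteq> 0" "\<delta> \<noteq> 0"
    and scaled: "a = \<alpha> *s a1" "b = \<beta> *s a2" "a3 = a + b"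
    and a5: "a5 = \<gamma> *s (a4 + (s *s a + t *s b))" and a6: "a6 = \<delta> *s (a4 + (s' *s a + t' *s b))"
    using normal_form[OF C] .
  interpret triple_point_lines a b a4 du dv dw s t s' t' by (rule L)
  have "x = const3 \<alpha> * lin a1" "y = const3 \<beta> * lin a2"
    unfolding x_def y_def unfolding scaled(1,2) lin_hom by (rule refl)+
  moreover have "w = lin a3" "X = lin a4" unfolding w_def X_def scaled(3) by (rule refl)+
  moreover have "lin a5 = const3 \<gamma> * Y" "lin a6 = const3 \<delta> * Z"
    unfolding Y_def Z_def lin_hom(4)[symmetric] a5[symmetric] a6[symmetric] by (rule refl)+
  ultimately have "const3 (\<gamma> * \<delta>) * f = const3 (\<alpha> * \<beta>) * F"
    unfolding F_def f_def const3_hom by (simp only:) (simp add: algebra_simps)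
  then have AR: "AR F = AR f" using AR_scale nz by (metis mult_eq_0_iff)
  have g: "g p q \<longleftrightarrow> on_pencil (cross p q)" for p q
    using nz unfolding g_def on_pencil_def scaled(3) unfolding scaled(1,2) by (simp add: dot_simps)
  have ps: "on_pencil (k *s n) \<longleftrightarrow> on_pencil n" if "k \<noteq> 0" for k n
    using that by (simp add: on_pencil_def dot_simps)
  have conds: "d \<in> ideal2 X Y \<longleftrightarrow> g a4 a5" "d' \<in> ideal2 X Z \<longleftrightarrow> g a4 a6" "d' - d \<in> ideal2 Y Z \<longleftrightarrow> g a5 a6"
    unfolding conditions_iff g unfolding a5 a6 cross_scale ps[OF nz(3)] ps[OF nz(4)] by (rule refl)+
  have conc: "dot cZ (cross a4 cY) = 0 \<longleftrightarrow> dot a6 (cross a4 a5) = 0"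
    unfolding a5 a6 using nz by (simp add: cross_scale dot_simps del: vector_add_ldistrib)
  show "has_min_gens (AR F) [3, 3, 4]" if h: "dot a6 (cross a4 a5) = 0" "\<not> g a4 a5"
  proof -
    obtain k where "s' = k * s" "t' = k * t" using h(1) unfolding conc[symmetric] by (rule concurrent_imp_pencil)
    then show ?thesis unfolding AR by (rule exponents_concurrent) (use h(2) conds(1) in blast)
  qed
  show "has_min_gens (AR F) [3, 4, 4, 4]" if "dot a6 (cross a4 a5) \<noteq> 0" "\<not> g a4 a5" "\<not> g a4 a6" "\<not> g a5 a6"
    unfolding AR by (rule exponents_three_conditions) (use that in \<open>simp_all add: conds concurrent_iff conc\<close>)
  show "has_min_gens (AR F) [3, 3, 4]" if "dot a6 (cross a4 a5) \<noteq> 0" "\<not> g a4 a5" "\<not> g a4 a6" "g a5 a6"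
    unfolding AR by (rule exponents_two_conditions) (use that in \<open>simp_all add: conds concurrent_iff conc\<close>)
  show "has_min_gens (AR F) [3, 3, 3]" if "\<not> g a4 a5" "g a4 a6" "g a5 a6"
    unfolding AR by (rule exponents_one_condition) (use that in \<open>simp_all add: conds\<close>)
  show "has_min_gens (AR F) [2, 3] \<and> (\<exists>B. syz.independent B \<and> syz.span B = AR F)"
    if "dot a6 (cross a4 a5) \<noteq> 0" "g a4 a5" "g a4 a6" "g a5 a6"
    unfolding AR by (rule free_if_no_condition) (use that in \<open>simp_all add: conds concurrent_iff conc\<close>)
qed

section \<open>Points of a line arrangement\<close>

lemma proj_pointsE:
  assumes "P \<in> proj_points" obtains v where "v \<noteq> 0" "P = vec.span {v}"
proof -
  have P: "vec.subspace P" "vec.dim P = 1" using assms by (auto simp: proj_points_def)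
  obtain B where B: "B \<subseteq> P" "vec.independent B" "P \<subseteq> vec.span B" "card B = vec.dim P"
    using vec.basis_exists by blast
  then obtain v where v: "B = {v}" using P(2) by (metis card_1_singletonE)
  have "v \<noteq> 0" using B(2) v vec.dependent_zero by blast
  moreover have "P = vec.span {v}" using B v P(1) vec.span_subspace by metis
  ultimately show ?thesis by (rule that)
qed

lemma span_in_proj_points: "v \<noteq> 0 \<Longrightarrow> vec.span {v} \<in> proj_points"
  by (simp add: proj_points_def vec.dim_singleton)

lemma on_line_span: "on_line (vec.span {v}) (lin a) \<longleftrightarrow> dot a v = 0"
proof
  assume "on_line (vec.span {v}) (lin a)"
  then show "dot a v = 0" by (simp add: on_line_def poly3_eval_lin vec.span_base)
next
  assume "dot a v = 0"
  then show "on_line (vec.span {v}) (lin a)"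
    by (auto simp: on_line_def poly3_eval_lin vec.span_singleton dot_simps)
qed

text \<open>
  The identity \<open>v \<times> (a \<times> b) = (b \<bullet> v) a - (a \<bullet> v) b\<close> shows that every common zero is proportional to
  \<open>cross a b\<close>.
\<close>

lemma on_two_lines_iff:
  assumes "cross a b \<noteq> 0" "P \<in> proj_points"
  shows "on_line P (lin a) \<and> on_line P (lin b) \<longleftrightarrow> P = vec.span {cross a b}"
proof
  assume on: "on_line P (lin a) \<and> on_line P (lin b)"
  obtain v where v: "v \<noteq> 0" "P = vec.span {v}" using assms(2) by (rule proj_pointsE)
  have "dot a v = 0" "dot b v = 0" using on by (simp_all add: v on_line_span)
  moreover have "cross v (cross a b) = dot b v *s a - dot a v *s b"
    by (simp add: vec3_simps algebra_simps)
  ultimately have "cross v (cross a b) = 0" by (simp add: vec3_simps)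
  then obtain k where k: "cross a b = k *s v" using cross_eq_0_imp_scale v(1) by blast
  with assms(1) have "k \<noteq> 0" by auto
  then have "v = (1 / k) *s cross a b" by (simp add: k)
  then have "v \<in> vec.span {cross a b}" "cross a b \<in> vec.span {v}"
    using k vec.span_scale vec.span_base by (metis singletonI)+
  then show "P = vec.span {cross a b}"
    unfolding v(2) by (simp add: vec.span_eq)
next
  assume "P = vec.span {cross a b}"
  then show "on_line P (lin a) \<and> on_line P (lin b)" by (simp add: on_line_span dot_cross_self)
qed

lemma arrangement_lines:
  assumes "line_arrangement A" "l \<in> A"
  obtains a where "l = lin a" "a \<noteq> 0"
  using assms homogeneous_1_imp_lin unfolding line_arrangement_def by (metis lin_0)

lemma arrangement_cross:
  assumes "line_arrangement A" "lin a \<in> A" "lin b \<in> A" "a \<noteq> b"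
  shows "cross a b \<noteq> 0"
proof
  assume z: "cross a b = 0"
  have nz: "a \<noteq> 0" "b \<noteq> 0" using assms(1-3) by (auto simp: line_arrangement_def)
  obtain c where c: "b = c *s a" using cross_eq_0_imp_scale[OF z nz(1)] by blast
  then have "c \<noteq> 0" using nz by auto
  then have "proportional (lin a) (lin b)"
    by (auto simp: proportional_def c lin_hom const3_def)
  with assms show False by (auto simp: line_arrangement_def)
qed

lemma arrangement_meet:
  assumes "line_arrangement A" "l \<in> A" "l' \<in> A" "l \<noteq> l'"
  shows "\<exists>!P. P \<in> proj_points \<and> on_line P l \<and> on_line P l'"
proof -
  obtain a b where ab: "l = lin a" "l' = lin b" using arrangement_lines assms by metis
  then have c: "cross a b \<noteq> 0" using arrangement_cross assms by blast
  show ?thesis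
  proof (rule ex1I)
    show "vec.span {cross a b} \<in> proj_points \<and> on_line (vec.span {cross a b}) l \<and> on_line (vec.span {cross a b}) l'"
      using span_in_proj_points[OF c] by (simp add: ab on_line_span dot_cross_self)
  qed (use on_two_lines_iff[OF c] ab in blast)
qed

text \<open>
  Any two lines meet in exactly one point, so the sets of pairs of lines through the multiple points
  partition the set of all pairs.
\<close>

lemma double_count_pairs:
  assumes A: "line_arrangement A"
  shows "finite {P \<in> proj_points. point_mult A P \<ge> 2}" (is "finite ?Q")
    and "(\<Sum>P | P \<in> proj_points \<and> point_mult A P \<ge> 2. point_mult A P choose 2) = card A choose 2"
proof -
  have fin: "finite A" using A by (simp add: line_arrangement_def)
  define L where "L P = {l \<in> A. on_line P l}" for P
  have finL: "finite (L P)" and LA: "L P \<subseteq> A" and mult: "point_mult A P = card (L P)" for P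
    using fin by (auto simp: L_def point_mult_def)
  define pairs where "pairs S = {B. B \<subseteq> S \<and> card B = 2}" for S :: "poly3 set"
  have uniq: "P = Q" if h: "P \<in> proj_points" "Q \<in> proj_points" "B \<in> pairs (L P)" "B \<in> pairs (L Q)" for P Q B
  proof -
    obtain l l' where "B = {l, l'}" "l \<noteq> l'" using h(3) by (auto simp: pairs_def card_2_iff)
    with h arrangement_meet[OF A, of l l'] show ?thesis by (auto simp: pairs_def L_def)
  qed
  have finp: "finite (pairs A)" unfolding pairs_def using fin by simp
  have sub: "pairs (L P) \<subseteq> pairs A" for P using LA by (auto simp: pairs_def)
  have ne: "pairs (L P) \<noteq> {}" if "P \<in> ?Q" for P
  proof -
    have "2 \<le> card (L P)" using that by (simp add: mult)
    then obtain B where "B \<subseteq> L P" "card B = 2" by (rule obtain_subset_with_card_n)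
    then have "B \<in> pairs (L P)" by (simp add: pairs_def)
    then show ?thesis by blast
  qed
  have "inj_on (\<lambda>P. pairs (L P)) ?Q"
  proof (rule inj_onI)
    fix P Q assume h: "P \<in> ?Q" "Q \<in> ?Q" "pairs (L P) = pairs (L Q)"
    then obtain B where "B \<in> pairs (L P)" using ne by blast
    with h uniq show "P = Q" by blast
  qed
  moreover have "(\<lambda>P. pairs (L P)) ` ?Q \<subseteq> Pow (pairs A)" using sub by auto
  ultimately show Q: "finite ?Q" using finp by (meson finite_Pow_iff finite_subset inj_on_finite)
  have U: "(\<Union>P\<in>?Q. pairs (L P)) = pairs A"
  proof (intro equalityI subsetI)
    fix B assume "B \<in> pairs A"
    then obtain l l' where B: "B = {l, l'}" "l \<noteq> l'" "l \<in> A" "l' \<in> A"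
      by (auto simp: pairs_def card_2_iff)
    then obtain P where P: "P \<in> proj_points" "on_line P l" "on_line P l'"
      using arrangement_meet[OF A] by metis
    then have B': "B \<in> pairs (L P)" using B by (auto simp: pairs_def L_def)
    then have "card (L P) \<ge> 2" using card_mono[OF finL[of P], of B] by (simp add: pairs_def)
    then show "B \<in> (\<Union>P\<in>?Q. pairs (L P))" using P B' by (auto simp: mult)
  qed (use sub in auto)
  have "card A choose 2 = card (pairs A)" unfolding pairs_def using n_subsets[OF fin] by simp
  also have "\<dots> = (\<Sum>P\<in>?Q. card (pairs (L P)))"
    unfolding U[symmetric]
  proof (rule card_UN_disjoint[OF Q])
    show "\<forall>P\<in>?Q. finite (pairs (L P))" using finite_subset[OF sub finp] by blast
    show "\<forall>P\<in>?Q. \<forall>R\<in>?Q. P \<noteq> R \<longrightarrow> pairs (L P) \<inter> pairs (L R) = {}" using uniq by blast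
  qed
  also have "\<dots> = (\<Sum>P\<in>?Q. point_mult A P choose 2)"
    unfolding pairs_def mult using n_subsets[OF finL] by simp
  finally show "(\<Sum>P\<in>?Q. point_mult A P choose 2) = card A choose 2" ..
qed

text \<open>
  The maximum is taken over a finite set since a multiplicity is at most the number of lines.
\<close>

lemma max_mult_3D:
  assumes A: "line_arrangement A" and m: "max_mult A = 3"
  shows "\<And>P. P \<in> proj_points \<Longrightarrow> point_mult A P \<le> 3"
    and "\<exists>P\<in>proj_points. point_mult A P = 3"
proof -
  have fin: "finite A" using A by (simp add: line_arrangement_def)
  have "point_mult A P \<le> card A" for P
    unfolding point_mult_def by (rule card_mono[OF fin]) auto
  then have "point_mult A ` proj_points \<subseteq> {..card A}" by (intro image_subsetI) (simp only: atMost_iff)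
  then have f: "finite (point_mult A ` proj_points)" by (rule finite_subset) simp
  have "vec.span {axis 1 1} \<in> proj_points" by (rule span_in_proj_points) simp
  then have ne: "point_mult A ` proj_points \<noteq> {}" by blast
  show "point_mult A P \<le> 3" if "P \<in> proj_points" for P
    using Max_ge[OF f imageI[OF that]] m unfolding max_mult_def by simp
  show "\<exists>P\<in>proj_points. point_mult A P = 3"
    using Max_in[OF f ne] m unfolding max_mult_def by (metis imageE)
qed

text \<open>
  Counting pairs of lines gives \<open>n\<^sub>2 + 3 n\<^sub>3 = 15\<close>, and \<open>\<tau> = n\<^sub>2 + 4 n\<^sub>3\<close>.
\<close>

lemma tjurina_6_lines:
  assumes A: "line_arrangement A" "card A = 6" and m: "max_mult A = 3"
  shows "total_tjurina A = 15 + num_points A 3"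
proof -
  note le = max_mult_3D(1)[OF A(1) m]
  define T where "T k = {P \<in> proj_points. point_mult A P = k}" for k
  have Q: "{P \<in> proj_points. point_mult A P \<ge> 2} = T 2 \<union> T 3"
  proof (intro equalityI subsetI)
    fix P assume "P \<in> {P \<in> proj_points. point_mult A P \<ge> 2}"
    then have "P \<in> proj_points" "2 \<le> point_mult A P" "point_mult A P \<le> 3" using le by simp_all
    then show "P \<in> T 2 \<union> T 3" by (simp add: T_def le_Suc_eq) linarith
  qed (auto simp: T_def)
  have fin: "finite (T 2)" "finite (T 3)"
    using double_count_pairs(1)[OF A(1)] unfolding Q by simp_all
  have "15 = (\<Sum>P\<in>T 2 \<union> T 3. point_mult A P choose 2)"
    using double_count_pairs(2)[OF A(1)] unfolding Q A(2) by (simp add: choose_two)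
  also have "\<dots> = (\<Sum>P\<in>T 2. point_mult A P choose 2) + (\<Sum>P\<in>T 3. point_mult A P choose 2)"
    by (rule sum.union_disjoint) (use fin in \<open>auto simp: T_def\<close>)
  also have "\<dots> = card (T 2) + 3 * card (T 3)"
    by (simp add: T_def choose_two)
  finally have 15: "15 = card (T 2) + 3 * card (T 3)" .
  have empty: "T k = {}" if "k > 3" for k using le that by (force simp: T_def)
  have "num_points A k = 0" if "k > 3" for k
    unfolding num_points_def T_def[symmetric] using empty[OF that] by simp
  then have "total_tjurina A = num_points A 2 + 4 * num_points A 3"
    unfolding total_tjurina_def A(2) by (simp add: eval_nat_numeral)
  then show ?thesis using 15 by (simp add: num_points_def T_def)
qed

section \<open>Counting the triple points\<close>

locale six_lines =
  fixes A and l1 l2 l3 l4 l5 l6 :: poly3 and P0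
  assumes arr: "line_arrangement A" and A_eq: "A = {l1, l2, l3, l4, l5, l6}"
    and distinct: "distinct [l1, l2, l3, l4, l5, l6]"
    and mult_le: "\<And>P. P \<in> proj_points \<Longrightarrow> point_mult A P \<le> 3"
    and P0: "P0 \<in> proj_points"
    and through_P0: "on_line P0 l1" "on_line P0 l2" "on_line P0 l3"
      "\<not> on_line P0 l4" "\<not> on_line P0 l5" "\<not> on_line P0 l6"
begin

definition meet where "meet l l' = (THE P. P \<in> proj_points \<and> on_line P l \<and> on_line P l')"

definition on_pencil_line where
  "on_pencil_line P \<longleftrightarrow> on_line P l1 \<or> on_line P l2 \<or> on_line P l3"

lemma meet_iff:
  assumes "l \<in> A" "l' \<in> A" "l \<noteq> l'" "P \<in> proj_points"
  shows "on_line P l \<and> on_line P l' \<longleftrightarrow> P = meet l l'"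
    and "meet l l' \<in> proj_points"
  using theI'[OF arrangement_meet[OF arr assms(1-3)]] arrangement_meet[OF arr assms(1-3)] assms(4)
  unfolding meet_def by blast+

lemma mult_eq:
  "point_mult A P = of_bool (on_line P l1) + of_bool (on_line P l2) + of_bool (on_line P l3)
     + of_bool (on_line P l4) + of_bool (on_line P l5) + of_bool (on_line P l6)"
proof -
  have "finite A" by (simp add: A_eq)
  then have "point_mult A P = (\<Sum>l\<in>A. of_bool (on_line P l))"
    unfolding point_mult_def by (simp add: of_bool_def sum.If_cases Int_def)
  then show ?thesis using distinct by (simp add: A_eq)
qed

lemma pencil_pairs:
  assumes "P \<in> proj_points" "P \<noteq> P0"
  shows "\<not> (on_line P l1 \<and> on_line P l2)" "\<not> (on_line P l1 \<and> on_line P l3)" "\<not> (on_line P l2 \<and> on_line P l3)"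
  using assms arrangement_meet[OF arr, of l1 l2] arrangement_meet[OF arr, of l1 l3]
    arrangement_meet[OF arr, of l2 l3] P0 through_P0 distinct A_eq by auto

text \<open>
  A triple point other than \<open>P0\<close> lies on at most one of \<open>l1\<close>, \<open>l2\<close>, \<open>l3\<close>, hence on two of \<open>l4\<close>, \<open>l5\<close>,
  \<open>l6\<close>; these meet only in \<open>Q\<close>.
\<close>

lemma triple_points_concurrent:
  assumes "Q \<in> proj_points" "on_line Q l4" "on_line Q l5" "on_line Q l6"
  shows "num_points A 3 = 2" "\<not> on_pencil_line Q"
proof -
  have "{P \<in> proj_points. point_mult A P = 3} = {P0, Q}"
  proof (intro equalityI subsetI)
    fix P assume P: "P \<in> {P \<in> proj_points. point_mult A P = 3}"
    show "P \<in> {P0, Q}"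
    proof (rule ccontr)
      assume n: "P \<notin> {P0, Q}"
      have "\<not> (on_line P l4 \<and> on_line P l5)" "\<not> (on_line P l4 \<and> on_line P l6)" "\<not> (on_line P l5 \<and> on_line P l6)"
        using n P assms arrangement_meet[OF arr, of l4 l5] arrangement_meet[OF arr, of l4 l6]
          arrangement_meet[OF arr, of l5 l6] distinct A_eq by auto
      with pencil_pairs[of P] P n show False
        by (auto simp: mult_eq of_bool_def split: if_splits)
    qed
  next
    fix P assume "P \<in> {P0, Q}"
    then show "P \<in> {P \<in> proj_points. point_mult A P = 3}"
      using P0 through_P0 assms mult_le[of P] by (auto simp: mult_eq)
  qed
  moreover have "P0 \<noteq> Q" using assms through_P0 by blast
  ultimately show "num_points A 3 = 2" by (simp add: num_points_def)
  show "\<not> on_pencil_line Q"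
    using mult_le[of Q] assms by (auto simp: mult_eq on_pencil_line_def)
qed

text \<open>
  As before, a triple point other than \<open>P0\<close> lies on two of \<open>l4\<close>, \<open>l5\<close>, \<open>l6\<close>; it cannot lie on the third
  one, so its third line passes through \<open>P0\<close>.
\<close>

lemma triple_points_not_concurrent:
  assumes "\<not> (\<exists>Q\<in>proj_points. on_line Q l4 \<and> on_line Q l5 \<and> on_line Q l6)"
  shows "num_points A 3 = 1 + of_bool (on_pencil_line (meet l4 l5))
    + of_bool (on_pencil_line (meet l4 l6)) + of_bool (on_pencil_line (meet l5 l6))"
proof -
  have inA: "l4 \<in> A" "l5 \<in> A" "l6 \<in> A" "l4 \<noteq> l5" "l4 \<noteq> l6" "l5 \<noteq> l6"
    using A_eq distinct by auto
  note m45 = meet_iff[OF inA(1,2,4)] and m46 = meet_iff[OF inA(1,3,5)] and m56 = meet_iff[OF inA(2,3,6)]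
  have pts: "meet l4 l5 \<in> proj_points" "meet l4 l6 \<in> proj_points" "meet l5 l6 \<in> proj_points"
    using m45(2) m46(2) m56(2) P0 by blast+
  have on: "on_line (meet l4 l5) l4" "on_line (meet l4 l5) l5" "on_line (meet l4 l6) l4"
    "on_line (meet l4 l6) l6" "on_line (meet l5 l6) l5" "on_line (meet l5 l6) l6"
    using m45(1) m46(1) m56(1) pts by blast+
  have ne: "meet l4 l5 \<noteq> meet l4 l6" "meet l4 l5 \<noteq> meet l5 l6" "meet l4 l6 \<noteq> meet l5 l6"
    "P0 \<noteq> meet l4 l5" "P0 \<noteq> meet l4 l6" "P0 \<noteq> meet l5 l6"
    using assms pts on through_P0 by metis+
  define D where "D = {P \<in> {meet l4 l5, meet l4 l6, meet l5 l6}. on_pencil_line P}"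
  have "{P \<in> proj_points. point_mult A P = 3} = insert P0 D"
  proof (intro equalityI subsetI)
    fix P assume P: "P \<in> {P \<in> proj_points. point_mult A P = 3}"
    show "P \<in> insert P0 D"
    proof (rule ccontr)
      assume n: "P \<notin> insert P0 D"
      have "\<not> (on_line P l4 \<and> on_line P l5 \<and> on_line P l6)" using assms P by blast
      moreover have "on_pencil_line P \<Longrightarrow> \<not> (on_line P l4 \<and> on_line P l5)"
        "on_pencil_line P \<Longrightarrow> \<not> (on_line P l4 \<and> on_line P l6)"
        "on_pencil_line P \<Longrightarrow> \<not> (on_line P l5 \<and> on_line P l6)"
        using n P m45(1) m46(1) m56(1) by (auto simp: D_def)
      ultimately show False using pencil_pairs[of P] P n
        by (auto simp: mult_eq of_bool_def on_pencil_line_def split: if_splits)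
    qed
  next
    fix P assume "P \<in> insert P0 D"
    then show "P \<in> {P \<in> proj_points. point_mult A P = 3}"
    proof
      assume "P = P0" then show ?thesis using P0 through_P0 by (simp add: mult_eq)
    next
      assume P: "P \<in> D"
      then have "P \<in> proj_points" using pts by (auto simp: D_def)
      moreover have "point_mult A P \<ge> 3" using P on by (auto simp: D_def mult_eq on_pencil_line_def)
      ultimately show ?thesis using mult_le[of P] by simp
    qed
  qed
  moreover have "P0 \<notin> D" "finite D" using ne by (auto simp: D_def)
  moreover have "card D = of_bool (on_pencil_line (meet l4 l5))
    + of_bool (on_pencil_line (meet l4 l6)) + of_bool (on_pencil_line (meet l5 l6))"
  proof -
    have "card D = (\<Sum>P\<in>{meet l4 l5, meet l4 l6, meet l5 l6}. of_bool (on_pencil_line P))"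
      unfolding D_def by (simp add: of_bool_def sum.If_cases Int_def)
    then show ?thesis using ne by simp
  qed
  ultimately show ?thesis by (simp add: num_points_def)
qed

text \<open>
  The line \<open>L\<close> is one of those through the only triple point: a node of the remaining lines that lies on
  \<open>L\<close> is a triple point of \<open>A\<close>.
\<close>

lemma remove_line_through_triple_point:
  assumes "num_points A 3 = 1"
  shows "\<exists>B L. line_arrangement B \<and> card B = 5 \<and> nodal B \<and>
     L \<notin> B \<and> A = insert L B \<and> card {P \<in> nodes B. on_line P L} = 1"
proof (intro exI conjI)
  let ?B = "{l2, l3, l4, l5, l6}"
  show "line_arrangement ?B" using arr by (auto simp: line_arrangement_def A_eq)
  show "card ?B = 5" "l1 \<notin> ?B" "A = insert l1 ?B" using distinct by (auto simp: A_eq)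
  have mult: "point_mult A P = point_mult ?B P + of_bool (on_line P l1)" for P
  proof -
    define S where "S = {l \<in> ?B. on_line P l}"
    have "{l \<in> A. on_line P l} = (if on_line P l1 then insert l1 S else S)"
      by (auto simp: A_eq S_def)
    moreover have "l1 \<notin> S" "finite S" using distinct by (auto simp: S_def)
    ultimately show ?thesis unfolding point_mult_def S_def[symmetric] by simp
  qed
  have P0_3: "point_mult A P0 = 3" using through_P0 by (simp add: mult_eq)
  have P0_eq: "P = P0" if "P \<in> proj_points" "point_mult A P = 3" for P
  proof -
    obtain R where "{P \<in> proj_points. point_mult A P = 3} = {R}"
      using assms unfolding num_points_def by (rule card_1_singletonE)
    then show ?thesis using that P0 P0_3 by blast
  qed
  show "nodal ?B"
    unfolding nodal_def
  proof (intro ballI impI)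
    fix P assume P: "P \<in> proj_points" "2 \<le> point_mult ?B P"
    show "point_mult ?B P = 2"
    proof (cases "P = P0")
      case True then show ?thesis using mult[of P] P0_3 through_P0 by simp
    next
      case False
      then have "point_mult A P \<noteq> 3" using P0_eq P(1) by blast
      then show ?thesis using mult[of P] mult_le[OF P(1)] P(2) by linarith
    qed
  qed
  have "{P \<in> nodes ?B. on_line P l1} = {P0}"
  proof (intro equalityI subsetI)
    fix P assume "P \<in> {P \<in> nodes ?B. on_line P l1}"
    then have P: "P \<in> proj_points" "point_mult ?B P = 2" "on_line P l1" by (simp_all add: nodes_def)
    then have "point_mult A P = 3" using mult[of P] by simp
    with P0_eq P(1) show "P \<in> {P0}" by blast
  next
    fix P assume "P \<in> {P0}"
    moreover have "point_mult ?B P0 = 2" using mult[of P0] P0_3 through_P0 by simp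
    ultimately show "P \<in> {P \<in> nodes ?B. on_line P l1}" using P0 through_P0 by (simp add: nodes_def)
  qed
  then show "card {P \<in> nodes ?B. on_line P l1} = 1" by simp
qed

end

section \<open>Exponents of arrangements of six lines\<close>

context six_lines begin

definition concurrent :: bool where
  "concurrent \<longleftrightarrow> (\<exists>Q\<in>proj_points. on_line Q l4 \<and> on_line Q l5 \<and> on_line Q l6)"

abbreviation triple :: "poly3 \<Rightarrow> poly3 \<Rightarrow> bool" where
  "triple l l' \<equiv> on_pencil_line (meet l l')"

lemma meet_commute: "meet l l' = meet l' l"
  unfolding meet_def by (rule arg_cong[where f = The]) blast

lemma swap_45: "six_lines A l1 l2 l3 l5 l4 l6 P0" and swap_46: "six_lines A l1 l2 l3 l6 l5 l4 P0"
  and swap_56: "six_lines A l1 l2 l3 l4 l6 l5 P0"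
  using arr A_eq distinct mult_le P0 through_P0 by (auto simp: six_lines_def)

lemma exponents:
  shows "concurrent \<Longrightarrow> has_min_gens (AR (def_poly A)) [3, 3, 4]"
    and "\<not> concurrent \<Longrightarrow> \<not> triple l4 l5 \<Longrightarrow> \<not> triple l4 l6 \<Longrightarrow> \<not> triple l5 l6 \<Longrightarrow>
      has_min_gens (AR (def_poly A)) [3, 4, 4, 4]"
    and "\<not> concurrent \<Longrightarrow> \<not> triple l4 l5 \<Longrightarrow> \<not> triple l4 l6 \<Longrightarrow> triple l5 l6 \<Longrightarrow>
      has_min_gens (AR (def_poly A)) [3, 3, 4]"
    and "\<not> triple l4 l5 \<Longrightarrow> triple l4 l6 \<Longrightarrow> triple l5 l6 \<Longrightarrow>
      has_min_gens (AR (def_poly A)) [3, 3, 3]"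
    and "\<not> concurrent \<Longrightarrow> triple l4 l5 \<Longrightarrow> triple l4 l6 \<Longrightarrow> triple l5 l6 \<Longrightarrow>
      has_min_gens (AR (def_poly A)) [2, 3] \<and> (\<exists>B. syz.independent B \<and> syz.span B = AR (def_poly A))"
proof -
  have "l1 \<in> A" "l2 \<in> A" "l3 \<in> A" "l4 \<in> A" "l5 \<in> A" "l6 \<in> A" using A_eq by auto
  then obtain a1 a2 a3 a4 a5 a6 where l: "l1 = lin a1" "l2 = lin a2" "l3 = lin a3"
    "l4 = lin a4" "l5 = lin a5" "l6 = lin a6"
    using arrangement_lines[OF arr] by metis
  have inA: "lin a1 \<in> A" "lin a2 \<in> A" "lin a3 \<in> A" "lin a4 \<in> A" "lin a5 \<in> A" "lin a6 \<in> A"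
    using A_eq l by auto
  have dist: "a1 \<noteq> a2" "a1 \<noteq> a3" "a2 \<noteq> a3" "a4 \<noteq> a5" "a4 \<noteq> a6" "a5 \<noteq> a6" using distinct l by auto
  note cr = arrangement_cross[OF arr]
  have cross: "cross a1 a2 \<noteq> 0" "cross a1 a3 \<noteq> 0" "cross a2 a3 \<noteq> 0"
    "cross a4 a5 \<noteq> 0" "cross a4 a6 \<noteq> 0" "cross a5 a6 \<noteq> 0"
    using cr inA dist by blast+
  have "P0 = vec.span {cross a1 a2}" using on_two_lines_iff[OF cross(1) P0] through_P0 l by simp
  then have C: "triple_point_config a1 a2 a3 a4 a5 a6"
    using cross through_P0 l by (simp add: triple_point_config_def on_line_span)
  have F: "def_poly A = lin a1 * lin a2 * lin a3 * lin a4 * lin a5 * lin a6"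
    using distinct by (simp add: def_poly_def A_eq l mult.assoc)
  have meet: "meet (lin p) (lin q) = vec.span {cross p q}" if "lin p \<in> A" "lin q \<in> A" "cross p q \<noteq> 0" for p q
  proof -
    have "lin p \<noteq> lin q" using that(3) by auto
    then show ?thesis
      using meet_iff[OF that(1,2)] on_two_lines_iff[OF that(3)] P0 by metis
  qed
  have g: "triple (lin p) (lin q) \<longleftrightarrow> dot a1 (cross p q) = 0 \<or> dot a2 (cross p q) = 0 \<or> dot a3 (cross p q) = 0"
    if "lin p \<in> A" "lin q \<in> A" "cross p q \<noteq> 0" for p q
    unfolding meet[OF that] on_pencil_line_def unfolding l(1-3) on_line_span by (rule refl)
  have conc: "concurrent \<longleftrightarrow> dot a6 (cross a4 a5) = 0"
  proof
    assume concurrent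
    then obtain Q where "Q \<in> proj_points" "on_line Q l4" "on_line Q l5" "on_line Q l6"
      by (auto simp: concurrent_def)
    with on_two_lines_iff[OF cross(4)] l show "dot a6 (cross a4 a5) = 0" by (metis on_line_span)
  next
    assume "dot a6 (cross a4 a5) = 0"
    then show concurrent unfolding concurrent_def unfolding l(4-6)
      by (intro bexI[of _ "vec.span {cross a4 a5}"])
         (simp_all add: on_line_span dot_cross_self span_in_proj_points cross)
  qed
  have t: "triple l4 l5 \<longleftrightarrow> dot a1 (cross a4 a5) = 0 \<or> dot a2 (cross a4 a5) = 0 \<or> dot a3 (cross a4 a5) = 0"
    "triple l4 l6 \<longleftrightarrow> dot a1 (cross a4 a6) = 0 \<or> dot a2 (cross a4 a6) = 0 \<or> dot a3 (cross a4 a6) = 0"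
    "triple l5 l6 \<longleftrightarrow> dot a1 (cross a5 a6) = 0 \<or> dot a2 (cross a5 a6) = 0 \<or> dot a3 (cross a5 a6) = 0"
    unfolding l(4-6) using g inA cross by blast+
  note ex = config_exponents[OF C, folded F t conc]
  show "has_min_gens (AR (def_poly A)) [3, 3, 4]" if conc: concurrent
  proof (rule ex(1)[OF conc])
    obtain Q where Q: "Q \<in> proj_points" "on_line Q l4" "on_line Q l5" "on_line Q l6"
      using conc by (auto simp: concurrent_def)
    have "l4 \<in> A" "l5 \<in> A" "l4 \<noteq> l5" using A_eq distinct by auto
    then have "Q = meet l4 l5" using meet_iff(1) Q by blast
    then show "\<not> triple l4 l5" using triple_points_concurrent(2)[OF Q] by simp
  qed
  show "has_min_gens (AR (def_poly A)) [3, 4, 4, 4]"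
    if "\<not> concurrent" "\<not> triple l4 l5" "\<not> triple l4 l6" "\<not> triple l5 l6"
    using ex(2) that by blast
  show "has_min_gens (AR (def_poly A)) [3, 3, 4]"
    if "\<not> concurrent" "\<not> triple l4 l5" "\<not> triple l4 l6" "triple l5 l6"
    using ex(3) that by blast
  show "has_min_gens (AR (def_poly A)) [3, 3, 3]"
    if "\<not> triple l4 l5" "triple l4 l6" "triple l5 l6"
    using ex(4) that by blast
  show "has_min_gens (AR (def_poly A)) [2, 3] \<and> (\<exists>B. syz.independent B \<and> syz.span B = AR (def_poly A))"
    if "\<not> concurrent" "triple l4 l5" "triple l4 l6" "triple l5 l6"
    using ex(5) that by blast
qed

lemma exponents_by_triple_points:
  "(num_points A 3 = 4 \<and> has_min_gens (AR (def_poly A)) [2, 3] \<and>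
      (\<exists>B. syz.independent B \<and> syz.span B = AR (def_poly A))) \<or>
   (num_points A 3 = 3 \<and> has_min_gens (AR (def_poly A)) [3, 3, 3]) \<or>
   (num_points A 3 = 2 \<and> has_min_gens (AR (def_poly A)) [3, 3, 4]) \<or>
   (num_points A 3 = 1 \<and> has_min_gens (AR (def_poly A)) [3, 4, 4, 4])"
proof (cases concurrent)
  case True
  then have "num_points A 3 = 2" using triple_points_concurrent(1) by (auto simp: concurrent_def)
  with exponents(1)[OF True] show ?thesis by blast
next
  case False
  have n: "num_points A 3 = 1 + of_bool (triple l4 l5) + of_bool (triple l4 l6) + of_bool (triple l5 l6)"
    using triple_points_not_concurrent False by (simp add: concurrent_def)
  interpret s45: six_lines A l1 l2 l3 l5 l4 l6 P0 by (rule swap_45)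
  interpret s46: six_lines A l1 l2 l3 l6 l5 l4 P0 by (rule swap_46)
  interpret s56: six_lines A l1 l2 l3 l4 l6 l5 P0 by (rule swap_56)
  have F: "\<not> s45.concurrent" "\<not> s46.concurrent" "\<not> s56.concurrent"
    using False unfolding concurrent_def s45.concurrent_def s46.concurrent_def s56.concurrent_def by blast+
  \<comment> \<open>the lemma on exponents fixes which points are triple; the other cases are permutations of \<open>l4, l5, l6\<close>\<close>
  consider "triple l4 l5" "triple l4 l6" "triple l5 l6"
    | "\<not> triple l4 l5" "triple l4 l6" "triple l5 l6"
    | "triple l4 l5" "\<not> triple l4 l6" "triple l5 l6"
    | "triple l4 l5" "triple l4 l6" "\<not> triple l5 l6"
    | "\<not> triple l4 l5" "\<not> triple l4 l6" "triple l5 l6"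
    | "\<not> triple l4 l5" "triple l4 l6" "\<not> triple l5 l6"
    | "triple l4 l5" "\<not> triple l4 l6" "\<not> triple l5 l6"
    | "\<not> triple l4 l5" "\<not> triple l4 l6" "\<not> triple l5 l6" by blast
  then show ?thesis
  proof cases
    case 1 then show ?thesis using exponents(5) False n by simp
  next
    case 2 then show ?thesis using exponents(4) n by simp
  next
    case 3 then show ?thesis using s56.exponents(4) n by (simp add: meet_commute[of l6 l5])
  next
    case 4 then show ?thesis using s46.exponents(4) n
      by (simp add: meet_commute[of l6 l5] meet_commute[of l6 l4] meet_commute[of l5 l4])
  next
    case 5 then show ?thesis using exponents(3) False n by simp
  next
    case 6 then show ?thesis using s45.exponents(3) F n by (simp add: meet_commute[of l5 l4])
  next
    case 7 then show ?thesis using s46.exponents(3) F n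
      by (simp add: meet_commute[of l6 l5] meet_commute[of l6 l4] meet_commute[of l5 l4])
  next
    case 8 then show ?thesis using exponents(2) False n by simp
  qed
qed

end

lemma has_exponents_iff: "has_exponents A es \<longleftrightarrow> sorted es \<and> has_min_gens (AR (def_poly A)) es"
  by (simp add: has_exponents_def has_min_gens_def)

theorem theorem3p1:
  fixes A :: "poly3 set"
  assumes "line_arrangement A" and "card A = 6" and "max_mult A = 3"
  shows
    "(total_tjurina A = 19 \<and> num_points A 3 = 4 \<and>
        free_arrangement A \<and> has_exponents A [2, 3]) \<or>
     (total_tjurina A = 18 \<and> num_points A 3 = 3 \<and>
        nearly_free A \<and> has_exponents A [3, 3, 3]) \<or>
     (total_tjurina A = 17 \<and> num_points A 3 = 2 \<and>
        minimal_POG A \<and> has_exponents A [3, 3, 4]) \<or>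
     (total_tjurina A = 16 \<and> num_points A 3 = 1 \<and>
        (\<exists>B L. line_arrangement B \<and> card B = 5 \<and> nodal B \<and>
               L \<notin> B \<and> A = insert L B \<and> card {P \<in> nodes B. on_line P L} = 1) \<and>
        has_type A 2 \<and> has_exponents A [3, 4, 4, 4])"
proof -
  have fin: "finite A" using assms(1) by (simp add: line_arrangement_def)
  obtain P0 where P0: "P0 \<in> proj_points" "point_mult A P0 = 3"
    using max_mult_3D(2)[OF assms(1,3)] by blast
  define L where "L = {l \<in> A. on_line P0 l}"
  have L: "card L = 3" "L \<subseteq> A" using P0(2) by (auto simp: L_def point_mult_def)
  have "card (A - L) = 3" using L assms(2) card_Diff_subset[of L A] fin finite_subset by fastforce
  with L(1) obtain l1 l2 l3 l4 l5 l6 where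
    l: "L = {l1, l2, l3}" "l1 \<noteq> l2" "l1 \<noteq> l3" "l2 \<noteq> l3"
      "A - L = {l4, l5, l6}" "l4 \<noteq> l5" "l4 \<noteq> l6" "l5 \<noteq> l6"
    by (metis card_3_iff)
  have "A = L \<union> (A - L)" using L(2) by blast
  then have A_eq: "A = {l1, l2, l3} \<union> {l4, l5, l6}" using l(1,5) by metis
  interpret six_lines A l1 l2 l3 l4 l5 l6 P0
  proof
    show "A = {l1, l2, l3, l4, l5, l6}" using A_eq by (simp only: Un_insert_left Un_empty_left)
    have in1: "l1 \<in> L" "l2 \<in> L" "l3 \<in> L" using l(1) by auto
    have in2: "l4 \<in> A - L" "l5 \<in> A - L" "l6 \<in> A - L" by (simp_all only: l(5)) simp_all
    have "\<And>l l'. l \<in> L \<Longrightarrow> l' \<in> A - L \<Longrightarrow> l \<noteq> l'" by blast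
    with in1 in2 have "l1 \<noteq> l4" "l1 \<noteq> l5" "l1 \<noteq> l6" "l2 \<noteq> l4" "l2 \<noteq> l5" "l2 \<noteq> l6"
      "l3 \<noteq> l4" "l3 \<noteq> l5" "l3 \<noteq> l6" by blast+
    with l(2-4,6-8) show "distinct [l1, l2, l3, l4, l5, l6]" by simp
    show "on_line P0 l1" "on_line P0 l2" "on_line P0 l3" using in1 by (auto simp: L_def)
    show "\<not> on_line P0 l4" "\<not> on_line P0 l5" "\<not> on_line P0 l6" using in2 by (auto simp: L_def)
    show "point_mult A P \<le> 3" if "P \<in> proj_points" for P by (rule max_mult_3D(1)[OF assms(1,3) that])
  qed (rule assms P0)+
  note tau = tjurina_6_lines[OF assms]
  from exponents_by_triple_points show ?thesis
  proof (elim disjE conjE)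
    assume h: "num_points A 3 = 4" "has_min_gens (AR (def_poly A)) [2, 3]"
      "\<exists>B. syz.independent B \<and> syz.span B = AR (def_poly A)"
    then have "total_tjurina A = 19" "has_exponents A [2, 3]" "free_arrangement A"
      by (simp_all add: tau has_exponents_iff free_arrangement_def)
    with h(1) show ?thesis by blast
  next
    assume h: "num_points A 3 = 3" "has_min_gens (AR (def_poly A)) [3, 3, 3]"
    then have "total_tjurina A = 18" and e: "has_exponents A [3, 3, 3]"
      by (simp_all add: tau has_exponents_iff)
    moreover have "nearly_free A"
      unfolding nearly_free_def plus_one_generated_def
      using e assms(2) by (intro exI[of _ 3]) simp
    ultimately show ?thesis using h(1) by blast
  next
    assume h: "num_points A 3 = 2" "has_min_gens (AR (def_poly A)) [3, 3, 4]"
    then have "total_tjurina A = 17" and e: "has_exponents A [3, 3, 4]"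
      by (simp_all add: tau has_exponents_iff)
    moreover have "minimal_POG A"
      unfolding minimal_POG_def plus_one_generated_def
      using e assms(2) by (intro exI[of _ 3] exI[of _ 4]) simp
    ultimately show ?thesis using h(1) by blast
  next
    assume h: "num_points A 3 = 1" "has_min_gens (AR (def_poly A)) [3, 4, 4, 4]"
    then have "total_tjurina A = 16" and e: "has_exponents A [3, 4, 4, 4]"
      by (simp_all add: tau has_exponents_iff)
    moreover have "has_type A 2"
      unfolding has_type_def
      using e assms(2) by (intro exI[of _ 3] exI[of _ 4] exI[of _ "[4, 4]"]) simp
    ultimately show ?thesis using h(1) remove_line_through_triple_point by blast
  qed
qed

end
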